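(* Let $\beta\in\mathbb{R}$. For every positive integer $D$, the complex manifold $\mathcal{L}(D)$ is invariant under the evolution of the $\beta$-Szegő equation $$i\partial_t u=\Pi(|u|^2u)-\beta\,S\,\Pi\big(|S^\dagger u|^2S^\dagger u\big),$$ that is, if $u$ is the solution with $u(0)=u_0\in\mathcal{L}(D)$, then $u(t)\in\mathcal{L}(D)$ for all $t\in\mathbb{R}$.
   Context: $L^2_+(\mathbb{S}^1)$ is the closed subspace of $L^2(\mathbb{S}^1)$ of functions $u=\sum_{n\ge 0}\alpha_ne^{in\theta}$; such $u$ is identified with $u(z)=\sum_{n\ge0}\alpha_nz^n$. $H^s_+(\mathbb{S}^1)=H^s(\mathbb{S}^1)\cap L^2_+(\mathbb{S}^1)$. $\Pi:L^2(\mathbb{S}^1)\to L^2_+(\mathbb{S}^1)$ is the Szegő projector (removing negative Fourier modes). $S$ is the shift $Sh=e^{i\theta}h$ on $L^2_+$, and $S^\dagger$ is its adjoint, $(S^\dagger h)_n=h_{n+1}$. The equation is globally well-posed in $H^s_+(\mathbb{S}^1)$ for $s>1/2$; "the solution" refers to this flow. $\mathcal{L}(D)$ is the set of rational functions $u(z)=A(z)/B(z)$ where $A,B$ are complex polynomials of degree at most $D$ with no common factors, $\deg A=D$ or $\deg B=D$, and $B$ has no zeros in the closed unit disk. *)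

theory Defs
  imports "HOL-Analysis.Analysis" "HOL-Computational_Algebra.Computational_Algebra"
begin

(* A function on the unit circle is given in the angle variable theta; only its values on
   [0, 2 pi] matter.  Elements of L^2 are represented by functions, so equality of two
   elements of L^2 is equality almost everywhere. *)

definition circle :: "real measure" where
  "circle = lebesgue_on {0..2 * pi}"

definition L2_circle :: "(real \<Rightarrow> complex) set" where
  "L2_circle = {f \<in> borel_measurable circle. integrable circle (\<lambda>\<theta>. (cmod (f \<theta>))\<^sup>2)}"

definition fourier_coeff :: "(real \<Rightarrow> complex) \<Rightarrow> int \<Rightarrow> complex" where
  "fourier_coeff f n =
     (LINT \<theta>|circle. f \<theta> * cis (- (real_of_int n * \<theta>))) / complex_of_real (2 * pi)"

definition L2_plus :: "(real \<Rightarrow> complex) set" where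
  "L2_plus = {f \<in> L2_circle. \<forall>n<0. fourier_coeff f n = 0}"

definition sobolev_terms :: "real \<Rightarrow> (real \<Rightarrow> complex) \<Rightarrow> int \<Rightarrow> real" where
  "sobolev_terms s f n = (1 + (real_of_int n)\<^sup>2) powr s * (cmod (fourier_coeff f n))\<^sup>2"

definition Hs_circle :: "real \<Rightarrow> (real \<Rightarrow> complex) set" where
  "Hs_circle s = {f \<in> L2_circle. sobolev_terms s f summable_on UNIV}"

definition Hs_plus :: "real \<Rightarrow> (real \<Rightarrow> complex) set" where
  "Hs_plus s = Hs_circle s \<inter> L2_plus"

(* Meaningful on Hs_circle s only: infsum is 0 for a divergent family. *)
definition Hs_norm :: "real \<Rightarrow> (real \<Rightarrow> complex) \<Rightarrow> real" where
  "Hs_norm s f = sqrt (\<Sum>\<^sub>\<infinity>n. sobolev_terms s f n)"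

(* For square-summable a, a representative of the element of L2_plus with Fourier
   coefficients a; it exists and is unique almost everywhere (Riesz-Fischer). *)
definition hardy_synth :: "(nat \<Rightarrow> complex) \<Rightarrow> real \<Rightarrow> complex" where
  "hardy_synth a = (SOME g. g \<in> L2_plus \<and> (\<forall>n. fourier_coeff g (int n) = a n))"

definition szego_proj :: "(real \<Rightarrow> complex) \<Rightarrow> real \<Rightarrow> complex" where
  "szego_proj f = hardy_synth (\<lambda>n. fourier_coeff f (int n))"

definition shift :: "(real \<Rightarrow> complex) \<Rightarrow> real \<Rightarrow> complex" where
  "shift h = (\<lambda>\<theta>. cis \<theta> * h \<theta>)"

definition shift_adj :: "(real \<Rightarrow> complex) \<Rightarrow> real \<Rightarrow> complex" where
  "shift_adj h = hardy_synth (\<lambda>n. fourier_coeff h (int (n + 1)))"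

definition cubic :: "(real \<Rightarrow> complex) \<Rightarrow> real \<Rightarrow> complex" where
  "cubic f = (\<lambda>\<theta>. (complex_of_real (cmod (f \<theta>)))\<^sup>2 * f \<theta>)"

definition beta_szego_rhs :: "real \<Rightarrow> (real \<Rightarrow> complex) \<Rightarrow> real \<Rightarrow> complex" where
  "beta_szego_rhs \<beta> v =
     (\<lambda>\<theta>. szego_proj (cubic v) \<theta>
        - complex_of_real \<beta> * shift (szego_proj (cubic (shift_adj v))) \<theta>)"

definition has_time_derivative ::
  "real \<Rightarrow> (real \<Rightarrow> real \<Rightarrow> complex) \<Rightarrow> (real \<Rightarrow> complex) \<Rightarrow> real \<Rightarrow> bool" where
  "has_time_derivative s u v t \<longleftrightarrow> v \<in> Hs_plus s \<and>
     ((\<lambda>h. Hs_norm s (\<lambda>\<theta>. (u (t + h) \<theta> - u t \<theta>) / complex_of_real h - v \<theta>)) \<longlongrightarrow> 0) (at 0)"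

definition beta_szego_solution :: "real \<Rightarrow> real \<Rightarrow> (real \<Rightarrow> real \<Rightarrow> complex) \<Rightarrow> bool" where
  "beta_szego_solution \<beta> s u \<longleftrightarrow>
     (\<forall>t. u t \<in> Hs_plus s) \<and>
     (\<forall>t. \<exists>v. has_time_derivative s u v t \<and>
            (AE \<theta> in circle. \<i> * v \<theta> = beta_szego_rhs \<beta> (u t) \<theta>))"

definition disc_fun :: "(real \<Rightarrow> complex) \<Rightarrow> complex \<Rightarrow> complex" where
  "disc_fun f z = (\<Sum>n. fourier_coeff f (int n) * z ^ n)"

(* The rational functions A/B, regarded as elements of L2_plus through disc_fun. *)
definition rational_manifold :: "nat \<Rightarrow> (real \<Rightarrow> complex) set" where
  "rational_manifold D = {f \<in> L2_plus. \<exists>A B :: complex poly.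
     degree A \<le> D \<and> degree B \<le> D \<and> coprime A B \<and> (degree A = D \<or> degree B = D) \<and>
     (\<forall>z\<in>cball 0 1. poly B z \<noteq> 0) \<and>
     (\<forall>z\<in>ball 0 1. disc_fun f z = poly A z / poly B z)}"

end

theory Submission
  imports Defs "HOL-Computational_Algebra.Field_as_Ring" "Jordan_Normal_Form.Determinant"
begin

text \<open>
  Write \<open>c\<^sub>n(t)\<close> for the Fourier coefficients of \<open>u(t)\<close>, which are absolutely summable because
  \<open>s > 1/2\<close>, and \<open>\<Gamma>\<^sub>j\<^sub>k = c\<^sub>j\<^sub>+\<^sub>k\<^sub>+\<^sub>1\<close> for the Hankel matrix of \<open>S\<^sup>\<dagger>u\<close>. By
  Kronecker's theorem \<open>u(t)\<close> is in \<open>L(D)\<close> if and only if \<open>\<Gamma>(t)\<close> has rank \<open>D\<close>; the denominator has no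
  zero in the closed disc since \<open>B u = A\<close> holds there and \<open>A, B\<close> are coprime.

  The Lax pair of the shifted Hankel operator survives in the weak form \<open>\<Gamma>' = X \<Gamma> + \<Gamma> Y\<close>, where the
  row sums of \<open>X\<close> and the column sums of \<open>Y\<close> are bounded locally uniformly in time. Hence the
  derivative of a minor of \<open>\<Gamma>\<close> is an absolutely convergent combination of minors of the same size, and
  Gronwall's inequality for their supremum shows that minors of a given size that all vanish at one time
  vanish at all times, forward and backward. So the rank of \<open>\<Gamma>\<close> is constant.
\<close>

section \<open>Fourier coefficients on the circle\<close>

text \<open>Two facts make the shifted Hankel matrix the right object. Dropping the constant
  coefficient makes its rank the larger of the two degrees in lowest terms, whereas the unshifted
  matrix would count deg A + 1. And in the modes n \<ge> 1 the \<beta>-term is the cubic coefficient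
  n - 1 of the shifted sequence, so it too becomes a sum of products with the same matrix, and
  \<beta> enters only as a scalar weight. Skew-adjointness of the generators plays no part:
  multilinearity of the determinant needs only absolutely summable rows against a bounded family of
  minors, and these come from the absolute summability of the coefficients of u. A supremum of
  infinitely many minors need not be differentiable in time, so the Gronwall estimate is integrated
  for each minor before the supremum is taken. Elements of L^2 are functions up to null sets and the
  projections are picked by a choice operator, so the nonlinearity can be computed in coefficients
  only after u(t) is identified almost everywhere with its Fourier series; uniqueness of Fourier
  coefficients supplies this.\<close>

lemma space_circle [simp]: "space circle = {0..2*pi}"
  by (simp add: circle_def)

lemma finite_measure_circle: "finite_measure circle"
  unfolding circle_def by (rule finite_measureI) (simp add: emeasure_restrict_space)

lemma measure_circle: "measure circle (space circle) = 2 * pi"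
  unfolding circle_def by (simp add: measure_restrict_space)

lemma continuous_measurable_circle:
  fixes g :: "real \<Rightarrow> 'a::euclidean_space"
  assumes "continuous_on UNIV g"
  shows "g \<in> borel_measurable circle"
  unfolding circle_def
  by (rule continuous_imp_measurable_on_sets_lebesgue) 
     (use assms continuous_on_subset in auto)

lemma integrable_circle_mult_continuous:
  fixes f g :: "real \<Rightarrow> complex"
  assumes f: "integrable circle f" and g: "continuous_on UNIV g" and b: "\<And>x. norm (g x) \<le> B"
  shows "integrable circle (\<lambda>x. f x * g x)"
proof (rule Bochner_Integration.integrable_bound)
  show "integrable circle (\<lambda>x. B * norm (f x))"
    using f by simp
  show "(\<lambda>x. f x * g x) \<in> borel_measurable circle"
    using borel_measurable_integrable[OF f] continuous_measurable_circle[OF g] by measurable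
  have "norm (f x * g x) \<le> norm (B * norm (f x))" for x
    using mult_right_mono[OF b, of "norm (f x)" x] by (simp add: norm_mult mult.commute)
  then show "AE x in circle. norm (f x * g x) \<le> norm (B * norm (f x))" by simp
qed

lemma integrable_circle_continuous:
  fixes g :: "real \<Rightarrow> complex"
  assumes "continuous_on UNIV g" and "\<And>x. norm (g x) \<le> B"
  shows "integrable circle g"
proof -
  have "integrable circle (\<lambda>_. 1 :: complex)"
    by (rule finite_measure.integrable_const[OF finite_measure_circle])
  from integrable_circle_mult_continuous[OF this assms] show ?thesis by simp
qed

lemma continuous_on_cis_mult: "continuous_on A (\<lambda>\<theta>. cis (r * \<theta>))"
  unfolding cis_conv_exp by (intro continuous_intros)

lemma integrable_circle_mult_cis:
  assumes "integrable circle f"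
  shows "integrable circle (\<lambda>\<theta>. f \<theta> * cis (r * \<theta>))"
  by (rule integrable_circle_mult_continuous[OF assms, where B=1])
     (simp_all add: continuous_on_cis_mult)

lemma L2_circle_integrable:
  assumes "f \<in> L2_circle"
  shows "integrable circle f"
proof -
  have f: "f \<in> borel_measurable circle" and f2: "integrable circle (\<lambda>\<theta>. (norm (f \<theta>))\<^sup>2)"
    using assms by (auto simp: L2_circle_def)
  have "integrable circle (\<lambda>\<theta>. norm (f \<theta>))"
    by (rule finite_measure.square_integrable_imp_integrable[OF finite_measure_circle _ f2])
       (use f in measurable)
  then show ?thesis
    using integrable_norm_iff[OF f] by simp
qed

lemma fourier_coeff_cong_AE:
  assumes "AE \<theta> in circle. f \<theta> = g \<theta>" "f \<in> borel_measurable circle" "g \<in> borel_measurable circle"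
  shows "fourier_coeff f n = fourier_coeff g n"
proof -
  have [measurable]: "(\<lambda>\<theta>. cis (- (real_of_int n * \<theta>))) \<in> borel_measurable circle"
    using continuous_measurable_circle[OF continuous_on_cis_mult, of "- real_of_int n"] by simp
  have "(LINT \<theta>|circle. f \<theta> * cis (- (real_of_int n * \<theta>))) = (LINT \<theta>|circle. g \<theta> * cis (- (real_of_int n * \<theta>)))"
  proof (rule integral_cong_AE)
    show "AE \<theta> in circle. f \<theta> * cis (- (real_of_int n * \<theta>)) = g \<theta> * cis (- (real_of_int n * \<theta>))"
      using assms(1) by eventually_elim simp
  qed (use assms(2,3) in measurable)
  then show ?thesis
    by (simp add: fourier_coeff_def)
qed

lemma fourier_coeff_integrable:
  assumes "integrable circle f"
  shows "integrable circle (\<lambda>\<theta>. f \<theta> * cis (- (real_of_int n * \<theta>)))"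
  using integrable_circle_mult_cis[OF assms, of "- real_of_int n"] by simp

lemma fourier_coeff_add:
  assumes "integrable circle f" "integrable circle g"
  shows "fourier_coeff (\<lambda>\<theta>. f \<theta> + g \<theta>) n = fourier_coeff f n + fourier_coeff g n"
  using assms by (simp add: fourier_coeff_def distrib_right fourier_coeff_integrable add_divide_distrib)

lemma fourier_coeff_diff:
  assumes "integrable circle f" "integrable circle g"
  shows "fourier_coeff (\<lambda>\<theta>. f \<theta> - g \<theta>) n = fourier_coeff f n - fourier_coeff g n"
  using assms by (simp add: fourier_coeff_def left_diff_distrib fourier_coeff_integrable diff_divide_distrib)

lemma fourier_coeff_cmult: "fourier_coeff (\<lambda>\<theta>. c * f \<theta>) n = c * fourier_coeff f n"
  by (simp add: fourier_coeff_def mult.assoc)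

lemma fourier_coeff_mult_cis:
  "fourier_coeff (\<lambda>\<theta>. f \<theta> * cis (real_of_int k * \<theta>)) n = fourier_coeff f (n - k)"
proof -
  have "cis (real_of_int k * \<theta>) * cis (- (real_of_int n * \<theta>)) = cis (- (real_of_int (n - k) * \<theta>))" for \<theta>
    by (simp add: cis_mult left_diff_distrib)
  then show ?thesis by (simp only: fourier_coeff_def mult.assoc)
qed

lemma fourier_coeff_norm_le:
  assumes "integrable circle f" "AE \<theta> in circle. norm (f \<theta>) \<le> B" "B \<ge> 0"
  shows "norm (fourier_coeff f n) \<le> B"
proof -
  have "norm (LINT \<theta>|circle. f \<theta> * cis (- (real_of_int n * \<theta>))) \<le> (LINT \<theta>|circle. norm (f \<theta> * cis (- (real_of_int n * \<theta>))))"
    by (rule integral_norm_bound)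
  also have "\<dots> \<le> (LINT \<theta>|circle. B)"
    by (rule integral_mono_AE)
       (use assms fourier_coeff_integrable[OF assms(1), of n] finite_measure.integrable_const[OF finite_measure_circle] in \<open>auto simp: norm_mult\<close>)
  also have "\<dots> = B * (2 * pi)"
    using measure_circle by (simp add: mult.commute)
  finally show ?thesis
    by (simp add: fourier_coeff_def norm_divide norm_mult field_simps)
qed

lemma integral_cis_int:
  "(LINT \<theta>|circle. cis (real_of_int k * \<theta>)) = (if k = 0 then complex_of_real (2 * pi) else 0)"
proof (cases "k = 0")
  case True
  then show ?thesis using measure_circle by (simp add: scaleR_conv_of_real)
next
  case False
  define F where "F = (\<lambda>\<theta>::real. cis (real_of_int k * \<theta>) / (\<i> * of_int k))"
  have "integral\<^sup>L lebesgue (\<lambda>\<theta>. indicator {0..2*pi} \<theta> *\<^sub>R cis (real_of_int k * \<theta>)) = F (2*pi) - F 0"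
  proof -
    have "has_bochner_integral lborel (\<lambda>x. indicator {0..2*pi} x *\<^sub>R cis (real_of_int k * x)) (F (2*pi) - F 0)"
    proof (rule has_bochner_integral_FTC_Icc)
      show "(F has_vector_derivative cis (real_of_int k * x)) (at x within {0..2*pi})" for x
      proof -
        have "((\<lambda>z. exp (\<i> * of_int k * z) / (\<i> * of_int k)) has_field_derivative
            exp (\<i> * of_int k * of_real x)) (at (of_real x))"
          using False by (auto intro!: derivative_eq_intros)
        from has_vector_derivative_real_field[OF this] show ?thesis
          by (simp add: F_def cis_conv_exp mult.assoc)
      qed
      show "continuous_on {0..2*pi} (\<lambda>x. cis (real_of_int k * x))"
        by (rule continuous_on_cis_mult)
    qed auto
    then have "integral\<^sup>L lborel (\<lambda>\<theta>. indicator {0..2*pi} \<theta> *\<^sub>R cis (real_of_int k * \<theta>)) = F (2*pi) - F 0"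
      by (rule has_bochner_integral_integral_eq)
    moreover have "(\<lambda>\<theta>. indicator {0..2*pi} \<theta> *\<^sub>R cis (real_of_int k * \<theta>)) \<in> borel_measurable lborel"
      using \<open>has_bochner_integral _ _ _\<close> by (auto dest: has_bochner_integral_implies_finite_norm simp: has_bochner_integral_iff)
    ultimately show ?thesis by (simp add: integral_completion)
  qed
  moreover have "F (2*pi) = F 0"
    using cis_multiple_2pi[of "real_of_int k"] by (simp add: F_def mult_ac)
  ultimately show ?thesis
    using False by (simp add: circle_def integral_restrict_space)
qed

lemma fourier_coeff_cis: "fourier_coeff (\<lambda>\<theta>. cis (real_of_int k * \<theta>)) n = (if n = k then 1 else 0)"
proof -
  have "cis (real_of_int k * \<theta>) * cis (- (real_of_int n * \<theta>)) = cis (real_of_int (k - n) * \<theta>)" for \<theta>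
    by (simp add: cis_mult left_diff_distrib)
  then show ?thesis by (simp add: fourier_coeff_def integral_cis_int del: of_int_diff)
qed

section \<open>Uniqueness of Fourier coefficients\<close>

text \<open>Real polynomials in the point \<open>cis \<theta>\<close> are trigonometric polynomials,
  and multiplying by an exponential only shifts the Fourier index. The function \<open>f\<close> is
  generalised in the induction because the product case applies the second factor to
  \<open>f\<close> times the first.\<close>

lemma fourier_coeff_zero_mult_polynomial:
  fixes g :: "complex \<Rightarrow> real"
  assumes "real_polynomial_function g" "integrable circle f" "\<And>n. fourier_coeff f n = 0"
  shows "integrable circle (\<lambda>\<theta>. f \<theta> * of_real (g (cis \<theta>))) \<and>
    (\<forall>n. fourier_coeff (\<lambda>\<theta>. f \<theta> * of_real (g (cis \<theta>))) n = 0)"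
  using assms
proof (induction arbitrary: f rule: real_polynomial_function.induct)
  case (linear g)
  \<comment> \<open>These are the coefficients of \<open>cis \<theta>\<close> and
    \<open>cis (-\<theta>)\<close> in \<open>cos \<theta> * g 1 + sin \<theta> * g \<i>\<close>, the
    value of a real-linear \<open>g\<close> at \<open>cis \<theta>\<close>.\<close>
  define p q where "p = complex_of_real (g 1) / 2 + of_real (g \<i>) / (2 * \<i>)"
    and "q = complex_of_real (g 1) / 2 - of_real (g \<i>) / (2 * \<i>)"
  have eq: "f \<theta> * of_real (g (cis \<theta>)) = p * (f \<theta> * cis (real_of_int 1 * \<theta>)) + q * (f \<theta> * cis (real_of_int (-1) * \<theta>))" for \<theta>
  proof -
    have "cis \<theta> = cos \<theta> *\<^sub>R 1 + sin \<theta> *\<^sub>R \<i>"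
      by (simp add: complex_eq_iff)
    then have "g (cis \<theta>) = cos \<theta> * g 1 + sin \<theta> * g \<i>"
      using bounded_linear.linear[OF linear(1)] by (simp only: linear_add linear_scale real_scaleR_def)
    moreover have "p * cis \<theta> + q * cis (-\<theta>) = of_real (cos \<theta> * g 1 + sin \<theta> * g \<i>)"
      by (simp add: p_def q_def complex_eq_iff)
    ultimately show ?thesis by (metis (no_types) distrib_left mult.left_commute mult_1 mult_minus1 of_int_1 of_int_minus)
  qed
  have "integrable circle (\<lambda>\<theta>. f \<theta> * cis (real_of_int k * \<theta>))" for k
    by (rule integrable_circle_mult_cis[OF linear(2)])
  then have i: "integrable circle (\<lambda>\<theta>. c * (f \<theta> * cis (real_of_int k * \<theta>)))" for k c
    by (rule integrable_mult_right)
  show ?case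
    unfolding eq fourier_coeff_add[OF i i] fourier_coeff_cmult fourier_coeff_mult_cis
    using Bochner_Integration.integrable_add[OF i[where c=p and k=1] i[where c=q and k="-1"]] linear(3) by simp
next
  case (const c)
  then show ?case
    using fourier_coeff_cmult[of "of_real c" f] by (simp add: mult.commute)
next
  case (add g h)
  have "integrable circle (\<lambda>\<theta>. f \<theta> * of_real (g (cis \<theta>)))" "integrable circle (\<lambda>\<theta>. f \<theta> * of_real (h (cis \<theta>)))"
    using add by blast+
  from Bochner_Integration.integrable_add[OF this] fourier_coeff_add[OF this] show ?case
    using add by (simp add: distrib_left)
next
  case (mult g h)
  from mult.IH(2)[of "\<lambda>\<theta>. f \<theta> * of_real (g (cis \<theta>))"] mult.IH(1)[OF mult.prems]
  show ?case by (simp add: mult.assoc)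
qed

text \<open>Stone-Weierstrass on the unit circle approximates \<open>F\<close> uniformly by real
  polynomials, for which the integral is zero; the error is at most \<open>e\<close> times the L^1
  norm of \<open>f\<close>.\<close>

lemma fourier_coeff_zero_continuous:
  fixes F :: "complex \<Rightarrow> real"
  assumes F: "continuous_on (sphere 0 1) F" and f: "integrable circle f" and z: "\<And>n. fourier_coeff f n = 0"
  shows "(LINT \<theta>|circle. f \<theta> * of_real (F (cis \<theta>))) = 0"
proof -
  have cm: "continuous_on UNIV (\<lambda>\<theta>. complex_of_real (G (cis \<theta>)))"
    and bd: "\<exists>B. \<forall>\<theta>. norm (complex_of_real (G (cis \<theta>))) \<le> B"
    if G: "continuous_on (sphere 0 1) G" for G :: "complex \<Rightarrow> real"
  proof -
    have "continuous_on UNIV (\<lambda>\<theta>. G (cis \<theta>))"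
      by (rule continuous_on_compose2[OF G]) (use continuous_on_cis_mult[of _ 1] in auto)
    then show "continuous_on UNIV (\<lambda>\<theta>. complex_of_real (G (cis \<theta>)))"
      by (intro continuous_intros)
    have "bounded (G ` sphere 0 1)"
      by (intro compact_imp_bounded compact_continuous_image G compact_sphere)
    then obtain B where "\<forall>x\<in>G ` sphere 0 1. norm x \<le> B"
      by (auto simp: bounded_iff)
    then show "\<exists>B. \<forall>\<theta>. norm (complex_of_real (G (cis \<theta>))) \<le> B"
      by (intro exI[of _ B]) auto
  qed
  have int: "integrable circle (\<lambda>\<theta>. f \<theta> * of_real (G (cis \<theta>)))" if "continuous_on (sphere 0 1) G" for G
    using bd[OF that] integrable_circle_mult_continuous[OF f cm[OF that]] by auto
  have "norm (LINT \<theta>|circle. f \<theta> * of_real (F (cis \<theta>))) \<le> e * (LINT \<theta>|circle. norm (f \<theta>))" if e: "e > 0" for e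
  proof -
    obtain g where g: "real_polynomial_function g" "\<And>x. x \<in> sphere 0 1 \<Longrightarrow> \<bar>F x - g x\<bar> < e"
      using Stone_Weierstrass_real_polynomial_function[OF compact_sphere F e] by blast
    have gc: "continuous_on (sphere 0 1) g"
      using g(1) by (simp add: continuous_on_polymonial_function real_polynomial_function_eq)
    have "(LINT \<theta>|circle. f \<theta> * of_real (g (cis \<theta>))) = 0"
      using fourier_coeff_zero_mult_polynomial[OF g(1) f z] by (auto simp: fourier_coeff_def dest: spec[of _ 0])
    then have "(LINT \<theta>|circle. f \<theta> * of_real (F (cis \<theta>))) = (LINT \<theta>|circle. f \<theta> * of_real (F (cis \<theta>)) - f \<theta> * of_real (g (cis \<theta>)))"
      by (simp add: int F gc)
    also have "norm \<dots> \<le> (LINT \<theta>|circle. norm (f \<theta> * of_real (F (cis \<theta>)) - f \<theta> * of_real (g (cis \<theta>))))"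
      by (rule integral_norm_bound)
    also have "\<dots> \<le> (LINT \<theta>|circle. e * norm (f \<theta>))"
    proof (rule integral_mono)
      fix \<theta>
      have "norm (f \<theta> * of_real (F (cis \<theta>)) - f \<theta> * of_real (g (cis \<theta>))) = norm (f \<theta>) * \<bar>F (cis \<theta>) - g (cis \<theta>)\<bar>"
        by (simp flip: right_diff_distrib of_real_diff add: norm_mult)
      also have "\<dots> \<le> norm (f \<theta>) * e"
        using g(2)[of "cis \<theta>"] by (intro mult_left_mono) auto
      finally show "norm (f \<theta> * of_real (F (cis \<theta>)) - f \<theta> * of_real (g (cis \<theta>))) \<le> e * norm (f \<theta>)"
        by (simp add: mult.commute)
    qed (use f in \<open>auto intro!: int F gc Bochner_Integration.integrable_diff\<close>)
    finally show ?thesis by simp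
  qed
  note * = this
  have "norm (LINT \<theta>|circle. f \<theta> * of_real (F (cis \<theta>))) \<le> 0"
  proof (rule field_le_epsilon)
    fix e :: real assume "e > 0"
    define I where "I = (LINT \<theta>|circle. norm (f \<theta>))"
    have "I \<ge> 0" unfolding I_def by simp
    \<comment> \<open>Dividing by \<open>I + 1\<close> rather than \<open>I\<close> covers the case
      of a vanishing L^1 norm.\<close>
    have "e / (I + 1) * I \<le> e" using \<open>e > 0\<close> \<open>I \<ge> 0\<close> by (simp add: field_simps)
    then show "norm (LINT \<theta>|circle. f \<theta> * of_real (F (cis \<theta>))) \<le> 0 + e"
      using *[of "e / (I+1)"] \<open>e > 0\<close> \<open>I \<ge> 0\<close> unfolding I_def[symmetric] by simp
  qed
  then show ?thesis by simp
qed

text \<open>The endpoints 0 and 2 pi are the same point of the circle; once they are discarded,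
  \<open>\<theta>\<close> is determined by \<open>cis \<theta>\<close>.\<close>

lemma AE_circle_open: "AE \<theta> in circle. 0 < \<theta> \<and> \<theta> < 2 * pi"
proof -
  have "{0, 2*pi} \<in> null_sets circle"
    unfolding circle_def by (subst null_sets_restrict_space) (auto simp flip: negligible_iff_null_sets)
  from AE_not_in[OF this] AE_space[of circle] show ?thesis
    by eventually_elim auto
qed

text \<open>The indicator of the compact image of \<open>K\<close> on the circle is a decreasing
  limit of continuous functions, so dominated convergence applies. Pulling back along
  \<open>cis\<close> returns the indicator of \<open>K\<close> except possibly at the two endpoints,
  a null set.\<close>

lemma fourier_coeff_zero_compact:
  assumes K: "compact K" "K \<subseteq> {0..2*pi}" and f: "integrable circle f" and z: "\<And>n. fourier_coeff f n = 0"
  shows "(LINT \<theta>|circle. indicator K \<theta> *\<^sub>R f \<theta>) = 0"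
proof (cases "K = {}")
  case False
  define C where "C = cis ` K"
  have C: "closed C" "C \<noteq> {}"
    unfolding C_def using K False continuous_on_cis_mult[of K 1]
    by (auto intro!: compact_imp_closed compact_continuous_image)
  \<comment> \<open>continuous functions on the circle decreasing to the indicator of \<open>C\<close>\<close>
  define F where "F = (\<lambda>(n::nat) w. max 0 (1 - real n * infdist w C))"
  have Fc: "continuous_on UNIV (F n)" for n
    unfolding F_def by (intro continuous_intros)
  have Fcm: "(\<lambda>\<theta>. complex_of_real (F n (cis \<theta>))) \<in> borel_measurable circle" for n
  proof (rule continuous_measurable_circle)
    have "continuous_on UNIV (\<lambda>\<theta>. F n (cis \<theta>))"
      by (rule continuous_on_compose2[OF Fc]) (use continuous_on_cis_mult[of _ 1] in auto)
    then show "continuous_on UNIV (\<lambda>\<theta>. complex_of_real (F n (cis \<theta>)))"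
      by (intro continuous_intros)
  qed
  have fm: "f \<in> borel_measurable circle" using f by auto
  have Km: "K \<in> sets circle"
    using K by (auto simp: circle_def sets_restrict_space_iff borel_compact)
  have "(\<lambda>n. LINT \<theta>|circle. f \<theta> * of_real (F n (cis \<theta>))) \<longlonglongrightarrow> (LINT \<theta>|circle. indicator K \<theta> *\<^sub>R f \<theta>)"
  proof (rule integral_dominated_convergence[where w = "\<lambda>\<theta>. norm (f \<theta>)"])
    show "AE \<theta> in circle. (\<lambda>n. f \<theta> * of_real (F n (cis \<theta>))) \<longlonglongrightarrow> indicator K \<theta> *\<^sub>R f \<theta>"
      using AE_circle_open
    proof eventually_elim
      case (elim \<theta>)
      have "(\<lambda>n. F n (cis \<theta>)) \<longlonglongrightarrow> indicator K \<theta>"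
      proof (cases "\<theta> \<in> K")
        case True
        then show ?thesis by (simp add: F_def C_def)
      next
        case False
        have "cis \<theta> \<notin> C"
        proof
          assume "cis \<theta> \<in> C"
          then obtain \<phi> where p: "\<phi> \<in> K" "cis \<theta> = cis \<phi>" by (auto simp: C_def)
          then have "cos (\<theta> - \<phi>) = 1"
            by (metis cis_divide cis_neq_zero cis.sel(1) divide_self one_complex.sel(1))
          then obtain k :: int where k: "\<theta> - \<phi> = k * 2 * pi"
            by (auto simp: cos_one_2pi_int)
          have "\<bar>\<theta> - \<phi>\<bar> < 2 * pi" using subsetD[OF K(2) p(1)] elim by auto
          then have "\<bar>real_of_int k\<bar> * (2 * pi) < 1 * (2 * pi)" using k by (simp add: abs_mult)
          then have "k = 0" by (simp only: mult_less_cancel_right) (use pi_gt_zero in linarith)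
          then show False using k p False by simp
        qed
        then have d: "infdist (cis \<theta>) C > 0"
          using C by (metis in_closed_iff_infdist_zero infdist_nonneg less_eq_real_def)
        have "\<forall>\<^sub>F n in sequentially. F n (cis \<theta>) = 0"
        proof -
          obtain N :: nat where N: "1 / infdist (cis \<theta>) C < real N" using reals_Archimedean2 by blast
          have "F n (cis \<theta>) = 0" if "n \<ge> N" for n
          proof -
            have "1 / infdist (cis \<theta>) C < real n" using N that by linarith
            then have "1 < real n * infdist (cis \<theta>) C" using d by (simp add: field_simps)
            then show ?thesis by (simp add: F_def)
          qed
          then show ?thesis by (auto simp: eventually_sequentially)
        qed
        then show ?thesis using False by (simp add: tendsto_eventually)
      qed
      then have "(\<lambda>n. f \<theta> * of_real (F n (cis \<theta>))) \<longlonglongrightarrow> f \<theta> * of_real (indicator K \<theta>)"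
        by (intro tendsto_intros)
      then show ?case by (simp add: scaleR_conv_of_real mult.commute)
    qed
    show "AE \<theta> in circle. norm (f \<theta> * of_real (F n (cis \<theta>))) \<le> norm (f \<theta>)" for n
    proof -
      have "\<bar>F n w\<bar> \<le> 1" for w by (auto simp: F_def infdist_nonneg)
      then show ?thesis by (auto simp: norm_mult intro!: mult_left_le)
    qed
    show "(\<lambda>\<theta>. indicator K \<theta> *\<^sub>R f \<theta>) \<in> borel_measurable circle"
      using fm Km by measurable
    show "(\<lambda>\<theta>. f \<theta> * of_real (F n (cis \<theta>))) \<in> borel_measurable circle" for n
      using fm Fcm by measurable
  qed (use f in auto)
  moreover have "(LINT \<theta>|circle. f \<theta> * of_real (F n (cis \<theta>))) = 0" for n
    using fourier_coeff_zero_continuous[OF continuous_on_subset[OF Fc] f z] by simp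
  ultimately show ?thesis by (simp add: LIMSEQ_const_iff)
qed simp

text \<open>A Lebesgue measurable set is an F-sigma set up to a null set, and in a bounded interval
  an F-sigma set is an increasing union of compact sets. So the integrals of \<open>f\<close> vanish
  over all measurable sets, which forces \<open>f = 0\<close> almost everywhere.\<close>

lemma fourier_coeff_unique_zero:
  assumes f: "integrable circle f" and z: "\<And>n. fourier_coeff f n = 0"
  shows "AE \<theta> in circle. f \<theta> = 0"
proof (rule sigma_finite_measure.density_zero[OF finite_measure.axioms(1)[OF finite_measure_circle] f])
  fix A assume A: "A \<in> sets circle"
  then have A': "A \<in> sets lebesgue" "A \<subseteq> {0..2*pi}"
    by (auto simp: circle_def sets_restrict_space_iff)
  obtain C T where CT: "fsigma C" "T \<in> null_sets lebesgue" "C \<union> T = A" "disjnt C T"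
    using lebesgue_set_almost_fsigma[OF A'(1)] by metis
  from CT(1) obtain F :: "nat \<Rightarrow> real set" where F: "\<And>n. closed (F n)" "C = \<Union>(F ` UNIV)"
    by (auto elim: fsigma.cases)
  define K where "K = (\<lambda>n. \<Union>i\<le>n. F i)"
  have K: "compact (K n)" "K n \<subseteq> {0..2*pi}" for n
  proof -
    show "K n \<subseteq> {0..2*pi}" using A'(2) CT(3) F(2) by (auto simp: K_def)
    then have "bounded (K n)" using bounded_closed_interval bounded_subset by blast
    moreover have "closed (K n)" unfolding K_def using F by auto
    ultimately show "compact (K n)" by (simp add: compact_eq_bounded_closed)
  qed
  have fm: "f \<in> borel_measurable circle" using f by auto
  have Km: "K n \<in> sets circle" for n
    using K[of n] by (auto simp: circle_def sets_restrict_space_iff borel_compact)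
  have "(\<Union>n. K n) = C" by (auto simp: K_def F(2))
  then have Cm: "C \<in> sets circle" using sets.countable_UN[where A=K and M=circle] Km by auto
  have "(\<lambda>n. LINT \<theta>|circle. indicator (K n) \<theta> *\<^sub>R f \<theta>) \<longlonglongrightarrow> (LINT \<theta>|circle. indicator C \<theta> *\<^sub>R f \<theta>)"
  proof (rule integral_dominated_convergence[where w = "\<lambda>\<theta>. norm (f \<theta>)"])
    show "AE \<theta> in circle. (\<lambda>n. indicator (K n) \<theta> *\<^sub>R f \<theta>) \<longlonglongrightarrow> indicator C \<theta> *\<^sub>R f \<theta>"
    proof (intro AE_I2 tendsto_intros)
      fix \<theta>
      have "\<forall>\<^sub>F n in sequentially. indicator (K n) \<theta> = (indicator C \<theta> :: real)"
      proof (cases "\<theta> \<in> C")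
        case True
        then obtain N where "\<theta> \<in> F N" using F(2) by auto
        then have "\<theta> \<in> K n" if "n \<ge> N" for n using that by (auto simp: K_def)
        then show ?thesis using True by (auto simp: eventually_sequentially intro!: exI[of _ N])
      qed (auto simp: K_def F(2))
      then show "(\<lambda>n. indicator (K n) \<theta> :: real) \<longlonglongrightarrow> indicator C \<theta>"
        by (rule tendsto_eventually)
    qed
    show "(\<lambda>\<theta>. indicator C \<theta> *\<^sub>R f \<theta>) \<in> borel_measurable circle" "(\<lambda>\<theta>. indicator (K n) \<theta> *\<^sub>R f \<theta>) \<in> borel_measurable circle" for n
      using fm Km[of n] Cm by measurable
  qed (use f in \<open>auto simp: indicator_def\<close>)
  then have C0: "(LINT \<theta>|circle. indicator C \<theta> *\<^sub>R f \<theta>) = 0"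
    using fourier_coeff_zero_compact[OF K f z] by (simp add: LIMSEQ_const_iff)
  have "T \<in> null_sets circle"
    using CT A'(2) unfolding circle_def
    by (subst null_sets_restrict_space) auto
  then have "AE \<theta> in circle. indicator C \<theta> *\<^sub>R f \<theta> = indicator A \<theta> *\<^sub>R f \<theta>"
    using AE_not_in CT(3) by (force simp: indicator_def)
  moreover have "(\<lambda>\<theta>. indicator C \<theta> *\<^sub>R f \<theta>) \<in> borel_measurable circle" "(\<lambda>\<theta>. indicator A \<theta> *\<^sub>R f \<theta>) \<in> borel_measurable circle"
    using fm A Cm by measurable
  ultimately show "set_lebesgue_integral circle A f = 0"
    using C0 integral_cong_AE unfolding set_lebesgue_integral_def by metis
qed

lemma fourier_coeff_unique:
  assumes "integrable circle f" "integrable circle g" "\<And>n. fourier_coeff f n = fourier_coeff g n"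
  shows "AE \<theta> in circle. f \<theta> = g \<theta>"
  using fourier_coeff_unique_zero[of "\<lambda>\<theta>. f \<theta> - g \<theta>"] assms by (simp add: fourier_coeff_diff)

section \<open>Absolutely convergent Fourier series and the cubic term\<close>

text \<open>Finite partial sums converge uniformly by the Weierstrass M-test, so Fourier
  coefficients pass to the limit. The arbitrary index type with a frequency map \<open>k\<close>
  serves both the simple series and the triple series of the cubic term, where many indices share
  one frequency.\<close>

lemma fourier_coeff_infsum:
  fixes c :: "'a \<Rightarrow> complex" and k :: "'a \<Rightarrow> int"
  assumes c: "(\<lambda>x. norm (c x)) summable_on UNIV"
  defines "g \<equiv> (\<lambda>\<theta>. \<Sum>\<^sub>\<infinity>x. c x * cis (of_int (k x) * \<theta>))"
  shows continuous_on_trig_infsum: "continuous_on UNIV g"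
    and norm_trig_infsum_le: "norm (g \<theta>) \<le> (\<Sum>\<^sub>\<infinity>x. norm (c x))"
    and fourier_coeff_trig_infsum: "fourier_coeff g n = (\<Sum>\<^sub>\<infinity>x\<in>{x. k x = n}. c x)"
proof -
  define p where "p = (\<lambda>F \<theta>. \<Sum>x\<in>F. c x * cis (of_int (k x) * \<theta>))"
  have pc: "continuous_on UNIV (p F)" for F
    unfolding p_def by (intro continuous_intros continuous_on_cis_mult)
  have pb: "norm (p F \<theta>) \<le> (\<Sum>x\<in>F. norm (c x))" for F \<theta>
    unfolding p_def by (rule sum_norm_le) (simp add: norm_mult)
  have ul: "uniform_limit UNIV p g (finite_subsets_at_top UNIV)"
    unfolding p_def g_def
    by (rule Weierstrass_m_test_general[OF _ c]) (simp add: norm_mult)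
  show gc: "continuous_on UNIV g"
    by (rule uniform_limit_theorem[OF _ ul]) (auto simp: pc)
  show gb: "norm (g \<theta>) \<le> (\<Sum>\<^sub>\<infinity>x. norm (c x))" for \<theta>
    using norm_infsum_bound[of "\<lambda>x. c x * cis (of_int (k x) * \<theta>)" UNIV] c
    unfolding g_def by (simp add: norm_mult)
  have pi: "integrable circle (p F)" for F
    by (rule integrable_circle_continuous[OF pc pb])
  have gi: "integrable circle g"
    by (rule integrable_circle_continuous[OF gc gb])
  have pf: "fourier_coeff (p F) n = (\<Sum>x\<in>F. if k x = n then c x else 0)" if "finite F" for F
    using that
  proof induction
    case empty
    show ?case by (simp add: p_def fourier_coeff_def)
  next
    case (insert x F)
    have i: "integrable circle (\<lambda>\<theta>. c x * cis (of_int (k x) * \<theta>))"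
      using pi[of "{x}"] by (simp add: p_def)
    have "p (insert x F) = (\<lambda>\<theta>. c x * cis (of_int (k x) * \<theta>) + p F \<theta>)"
      using insert by (simp add: p_def)
    then have "fourier_coeff (p (insert x F)) n = c x * (if n = k x then 1 else 0) + fourier_coeff (p F) n"
      using fourier_coeff_add[OF i pi] fourier_coeff_cmult[of "c x"] fourier_coeff_cis by simp
    then show ?case using insert by simp
  qed
  have "((\<lambda>F. fourier_coeff (p F) n) \<longlongrightarrow> fourier_coeff g n) (finite_subsets_at_top UNIV)"
  proof (rule tendstoI)
    fix e :: real assume "e > 0"
    then have "\<forall>\<^sub>F F in finite_subsets_at_top UNIV. \<forall>\<theta>\<in>UNIV. dist (p F \<theta>) (g \<theta>) < e / 2"
      using uniform_limitD[OF ul, of "e/2"] by simp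
    then show "\<forall>\<^sub>F F in finite_subsets_at_top UNIV. dist (fourier_coeff (p F) n) (fourier_coeff g n) < e"
    proof eventually_elim
      case (elim F)
      have "norm (fourier_coeff (\<lambda>\<theta>. p F \<theta> - g \<theta>) n) \<le> e / 2"
        by (rule fourier_coeff_norm_le) (use elim \<open>e > 0\<close> pi gi in \<open>auto simp: dist_norm less_imp_le\<close>)
      then show ?case using \<open>e > 0\<close> by (simp add: fourier_coeff_diff[OF pi gi] dist_norm)
    qed
  qed
  then have "((\<lambda>F. \<Sum>x\<in>F. if k x = n then c x else 0) \<longlongrightarrow> fourier_coeff g n) (finite_subsets_at_top UNIV)"
    by (rule Lim_transform_eventually) (auto intro!: eventually_finite_subsets_at_top_weakI simp: pf)
  then have "((\<lambda>x. if k x = n then c x else 0) has_sum fourier_coeff g n) UNIV"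
    by (simp add: has_sum_def)
  then have "(c has_sum fourier_coeff g n) {x. k x = n}"
    by (subst has_sum_cong_neutral[where T=UNIV and g="\<lambda>x. if k x = n then c x else 0"]) auto
  then show "fourier_coeff g n = (\<Sum>\<^sub>\<infinity>x\<in>{x. k x = n}. c x)"
    by (simp add: infsumI)
qed

section \<open>One-sided absolutely convergent series as elements of the Hardy space\<close>

lemma continuous_bounded_L2_circle:
  assumes "continuous_on UNIV g" "\<And>x. norm (g x) \<le> B"
  shows "g \<in> L2_circle"
proof -
  have "integrable circle (\<lambda>\<theta>. (norm (g \<theta>))\<^sup>2)"
  proof (rule finite_measure.integrable_const_bound[OF finite_measure_circle, where B = "B\<^sup>2"])
    show "AE \<theta> in circle. norm ((norm (g \<theta>))\<^sup>2) \<le> B\<^sup>2"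
      using assms(2) by (simp add: power_mono)
    show "(\<lambda>\<theta>. (norm (g \<theta>))\<^sup>2) \<in> borel_measurable circle"
      using continuous_measurable_circle[OF assms(1)] by measurable
  qed
  then show ?thesis
    using continuous_measurable_circle[OF assms(1)] by (simp add: L2_circle_def)
qed

text \<open>For absolutely summable \<open>a\<close> this is a concrete witness for the choice in
  \<open>hardy_synth\<close>. The form \<open>of_int (int n)\<close> exhibits \<open>int\<close> as
  the frequency map of the general series lemma.\<close>

definition trig_series :: "(nat \<Rightarrow> complex) \<Rightarrow> real \<Rightarrow> complex" where
  "trig_series a = (\<lambda>\<theta>. \<Sum>\<^sub>\<infinity>n. a n * cis (of_int (int n) * \<theta>))"

lemma trig_series_props:
  assumes a: "(\<lambda>n. norm (a n)) summable_on UNIV"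
  shows continuous_trig_series: "continuous_on UNIV (trig_series a)"
    and norm_trig_series_le: "norm (trig_series a \<theta>) \<le> (\<Sum>\<^sub>\<infinity>n. norm (a n))"
    and fourier_coeff_trig_series: "fourier_coeff (trig_series a) n = (if n \<ge> 0 then a (nat n) else 0)"
    and trig_series_L2_plus: "trig_series a \<in> L2_plus"
proof -
  show c: "continuous_on UNIV (trig_series a)"
    unfolding trig_series_def by (rule continuous_on_trig_infsum[OF a])
  show b: "norm (trig_series a \<theta>) \<le> (\<Sum>\<^sub>\<infinity>n. norm (a n))" for \<theta>
    unfolding trig_series_def by (rule norm_trig_infsum_le[OF a])
  show f: "fourier_coeff (trig_series a) n = (if n \<ge> 0 then a (nat n) else 0)" for n
  proof -
    have "{m. int m = n} = (if n \<ge> 0 then {nat n} else {})" by auto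
    then show ?thesis
      unfolding trig_series_def fourier_coeff_trig_infsum[OF a] by simp
  qed
  show "trig_series a \<in> L2_plus"
    using continuous_bounded_L2_circle[OF c b] by (simp add: L2_plus_def f)
qed

lemma hardy_synth_props:
  assumes a: "(\<lambda>n. norm (a n)) summable_on UNIV"
  shows hardy_synth_L2_plus: "hardy_synth a \<in> L2_plus"
    and fourier_coeff_hardy_synth: "fourier_coeff (hardy_synth a) (int n) = a n"
proof -
  have "\<exists>g. g \<in> L2_plus \<and> (\<forall>n. fourier_coeff g (int n) = a n)"
    using trig_series_props[OF a] by (intro exI[of _ "trig_series a"]) simp
  from someI_ex[OF this] show "hardy_synth a \<in> L2_plus" "fourier_coeff (hardy_synth a) (int n) = a n"
    by (auto simp: hardy_synth_def)
qed

lemma L2_plus_integrable: "f \<in> L2_plus \<Longrightarrow> integrable circle f"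
  by (simp add: L2_plus_def L2_circle_integrable)

lemma L2_plus_AE_trig_series:
  assumes f: "f \<in> L2_plus" and a: "(\<lambda>n. norm (fourier_coeff f (int n))) summable_on UNIV"
  shows "AE \<theta> in circle. f \<theta> = trig_series (\<lambda>n. fourier_coeff f (int n)) \<theta>"
proof (rule fourier_coeff_unique)
  show "fourier_coeff f n = fourier_coeff (trig_series (\<lambda>n. fourier_coeff f (int n))) n" for n
    using f by (simp add: fourier_coeff_trig_series[OF a] L2_plus_def)
qed (use f trig_series_L2_plus[OF a] in \<open>simp_all add: L2_plus_integrable\<close>)

section \<open>The cubic nonlinearity as a convolution of coefficients\<close>

definition cubic_term :: "(nat \<Rightarrow> complex) \<Rightarrow> nat \<times> nat \<times> nat \<Rightarrow> complex" where
  "cubic_term a = (\<lambda>(l, p, m). a l * cnj (a p) * a m)"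

text \<open>The conjugated factor has index \<open>p\<close>, so a triple has frequency
  \<open>l - p + m\<close>; the constraint is this frequency equal to \<open>n\<close>, written
  without subtraction of naturals.\<close>

definition cubic_coeff :: "(nat \<Rightarrow> complex) \<Rightarrow> nat \<Rightarrow> complex" where
  "cubic_coeff a n = (\<Sum>\<^sub>\<infinity>x\<in>{(l, p, m). l + m = p + n}. cubic_term a x)"

lemma abs_summable_prod:
  fixes f :: "'a \<Rightarrow> complex" and g :: "'b \<Rightarrow> complex"
  assumes f: "(\<lambda>x. norm (f x)) summable_on UNIV" and g: "(\<lambda>y. norm (g y)) summable_on UNIV"
  shows "(\<lambda>z. norm (f (fst z) * g (snd z))) summable_on UNIV"
    and "(\<Sum>\<^sub>\<infinity>z. f (fst z) * g (snd z)) = (\<Sum>\<^sub>\<infinity>x. f x) * (\<Sum>\<^sub>\<infinity>y. g y)"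
    and "(\<Sum>\<^sub>\<infinity>z. norm (f (fst z) * g (snd z))) = (\<Sum>\<^sub>\<infinity>x. norm (f x)) * (\<Sum>\<^sub>\<infinity>y. norm (g y))"
proof -
  have "(\<lambda>z. norm (f (fst z) * g (snd z))) summable_on (SIGMA x:UNIV. UNIV)"
    by (rule Infinite_Sum.abs_summable_on_Sigma_iff[THEN iffD2]) (use f g in \<open>auto simp: norm_mult infsum_cmult_right' infsum_nonneg abs_mult
        intro!: summable_on_cmult_right summable_on_cmult_left\<close>)
  then show s: "(\<lambda>z. norm (f (fst z) * g (snd z))) summable_on UNIV"
    by simp
  then have s': "(\<lambda>z. f (fst z) * g (snd z)) summable_on UNIV"
    by (rule abs_summable_summable)
  have "(\<Sum>\<^sub>\<infinity>z. f (fst z) * g (snd z)) = (\<Sum>\<^sub>\<infinity>x. \<Sum>\<^sub>\<infinity>y. f x * g y)"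
    using infsum_Sigma_banach[of "\<lambda>z. f (fst z) * g (snd z)" UNIV "\<lambda>_. UNIV"] s' by simp
  then show "(\<Sum>\<^sub>\<infinity>z. f (fst z) * g (snd z)) = (\<Sum>\<^sub>\<infinity>x. f x) * (\<Sum>\<^sub>\<infinity>y. g y)"
    by (simp add: infsum_cmult_right' infsum_cmult_left')
  have "(\<Sum>\<^sub>\<infinity>z. norm (f (fst z) * g (snd z))) = (\<Sum>\<^sub>\<infinity>x. \<Sum>\<^sub>\<infinity>y. norm (f x * g y))"
    using infsum_Sigma_banach[of "\<lambda>z. norm (f (fst z) * g (snd z))" UNIV "\<lambda>_. UNIV"] s by simp
  then show "(\<Sum>\<^sub>\<infinity>z. norm (f (fst z) * g (snd z))) = (\<Sum>\<^sub>\<infinity>x. norm (f x)) * (\<Sum>\<^sub>\<infinity>y. norm (g y))"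
    by (simp add: norm_mult infsum_cmult_right' infsum_cmult_left')
qed

lemma cubic_term_abs_summable:
  assumes a: "(\<lambda>n. norm (a n)) summable_on UNIV"
  shows "(\<lambda>x. norm (cubic_term a x)) summable_on UNIV"
proof -
  have a': "(\<lambda>n. norm (cnj (a n))) summable_on UNIV" using a by simp
  have "(\<lambda>z. norm (cnj (a (fst z)) * a (snd z))) summable_on UNIV"
    by (rule abs_summable_prod[OF a' a])
  from abs_summable_prod(1)[OF a this] show ?thesis
    by (simp add: cubic_term_def case_prod_beta mult.assoc)
qed

lemma cubic_trig_series:
  assumes a: "(\<lambda>n. norm (a n)) summable_on UNIV"
  shows "cubic (trig_series a) \<theta> =
    (\<Sum>\<^sub>\<infinity>x. cubic_term a x * cis (of_int ((\<lambda>(l, p, m). int l - int p + int m) x) * \<theta>))"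
proof -
  define b where "b = (\<lambda>n. a n * cis (of_int (int n) * \<theta>))"
  have b: "(\<lambda>n. norm (b n)) summable_on UNIV" using a by (simp add: b_def norm_mult)
  then have b': "(\<lambda>n. norm (cnj (b n))) summable_on UNIV" by simp
  define w where "w = trig_series a \<theta>"
  have w1: "w = (\<Sum>\<^sub>\<infinity>n. b n)"
    by (simp add: w_def trig_series_def b_def)
  have w: "w = (\<Sum>\<^sub>\<infinity>n. b n)" "cnj w = (\<Sum>\<^sub>\<infinity>n. cnj (b n))"
    unfolding w1 by (simp_all only: infsum_cnj)
  have "cubic (trig_series a) \<theta> = w * (cnj w * w)"
    using complex_norm_square[of w] by (simp add: cubic_def w_def mult_ac)
  then have "cubic (trig_series a) \<theta> = (\<Sum>\<^sub>\<infinity>n. b n) * ((\<Sum>\<^sub>\<infinity>n. cnj (b n)) * (\<Sum>\<^sub>\<infinity>n. b n))"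
    by (simp only: w(2)[symmetric] w(1)[symmetric])
  also have "\<dots> = (\<Sum>\<^sub>\<infinity>x. b (fst x) * (cnj (b (fst (snd x))) * b (snd (snd x))))"
    using abs_summable_prod(2)[OF b abs_summable_prod(1)[OF b' b]] abs_summable_prod(2)[OF b' b] by simp
  also have "\<dots> = (\<Sum>\<^sub>\<infinity>x. cubic_term a x * cis (of_int ((\<lambda>(l, p, m). int l - int p + int m) x) * \<theta>))"
  proof (rule infsum_cong)
    fix x :: "nat \<times> nat \<times> nat"
    obtain l p m where x: "x = (l, p, m)" by (metis prod.exhaust)
    have "cis (of_int (int l) * \<theta>) * (cis (- (of_int (int p) * \<theta>)) * cis (of_int (int m) * \<theta>)) = cis (of_int (int l - int p + int m) * \<theta>)"
      by (simp add: cis_mult algebra_simps)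
    then show "b (fst x) * (cnj (b (fst (snd x))) * b (snd (snd x))) = cubic_term a x * cis (of_int ((\<lambda>(l, p, m). int l - int p + int m) x) * \<theta>)"
      by (simp add: x b_def cubic_term_def cis_cnj mult_ac flip: of_int_diff of_int_add)
  qed
  finally show ?thesis .
qed

text \<open>The triple series is a pointwise identity for \<open>trig_series\<close> only;
  \<open>f\<close> agrees with it almost everywhere, which is enough for the integrals.\<close>

lemma fourier_coeff_cubic:
  assumes f: "f \<in> L2_plus" and a: "(\<lambda>n. norm (fourier_coeff f (int n))) summable_on UNIV"
  shows "fourier_coeff (cubic f) (int n) = cubic_coeff (\<lambda>n. fourier_coeff f (int n)) n"
proof -
  define a where "a = (\<lambda>n. fourier_coeff f (int n))"
  have a': "(\<lambda>n. norm (a n)) summable_on UNIV" using a by (simp add: a_def)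
  have [measurable]: "f \<in> borel_measurable circle" "trig_series a \<in> borel_measurable circle"
    using f continuous_measurable_circle[OF continuous_trig_series[OF a']] by (auto simp: L2_plus_def L2_circle_def)
  have "AE \<theta> in circle. cubic f \<theta> = cubic (trig_series a) \<theta>"
    using L2_plus_AE_trig_series[OF f a] unfolding a_def by eventually_elim (simp add: cubic_def)
  then have "fourier_coeff (cubic f) (int n) = fourier_coeff (cubic (trig_series a)) (int n)"
    by (rule fourier_coeff_cong_AE) (simp_all add: cubic_def)
  also have "\<dots> = (\<Sum>\<^sub>\<infinity>x\<in>{x. (\<lambda>(l, p, m). int l - int p + int m) x = int n}. cubic_term a x)"
    using fourier_coeff_trig_infsum[OF cubic_term_abs_summable[OF a'], of "\<lambda>(l, p, m). int l - int p + int m" "int n"]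
    by (simp add: cubic_trig_series[OF a', abs_def])
  also have "{x. (\<lambda>(l, p, m). int l - int p + int m) x = int n} = {(l, p, m). l + m = p + n}" by auto
  finally show ?thesis by (simp add: cubic_coeff_def a_def)
qed

text \<open>The sets \<open>S i\<close> are disjoint but need not exhaust the index type, so summing
  inside each of them before taking norms can only decrease the total. This one fact bounds the
  cubic coefficients and the rows of both matrices that factor them.\<close>

lemma abs_summable_fibres:
  fixes f :: "'a \<Rightarrow> complex" and S :: "'b \<Rightarrow> 'a set"
  assumes f: "(\<lambda>x. norm (f x)) summable_on UNIV" and disj: "\<And>i j. i \<noteq> j \<Longrightarrow> S i \<inter> S j = {}"
  shows "(\<lambda>i. norm (\<Sum>\<^sub>\<infinity>x\<in>S i. f x)) summable_on UNIV"
    and "(\<Sum>\<^sub>\<infinity>i. norm (\<Sum>\<^sub>\<infinity>x\<in>S i. f x)) \<le> (\<Sum>\<^sub>\<infinity>x. norm (f x))"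
proof -
  have inj: "inj_on snd (Sigma UNIV S)" using disj by (auto simp: inj_on_def)
  have fs: "(\<lambda>x. norm (f x)) summable_on (snd ` Sigma UNIV S)"
    using summable_on_subset_banach[OF f] by auto
  then have s: "(\<lambda>z. norm (f (snd z))) summable_on (Sigma UNIV S)"
    using summable_on_reindex[OF inj, of "\<lambda>x. norm (f x)"] by (simp add: o_def)
  have n: "norm (\<Sum>\<^sub>\<infinity>x\<in>S i. f x) \<le> (\<Sum>\<^sub>\<infinity>x\<in>S i. norm (f x))" for i
    by (rule norm_infsum_bound) (use summable_on_subset_banach[OF f] in auto)
  have s1: "(\<lambda>i. \<Sum>\<^sub>\<infinity>x\<in>S i. norm (f x)) summable_on UNIV"
    using summable_on_Sigma_banach[of "\<lambda>i x. norm (f x)" UNIV S] s by (simp add: case_prod_unfold)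
  then show s2: "(\<lambda>i. norm (\<Sum>\<^sub>\<infinity>x\<in>S i. f x)) summable_on UNIV"
    by (rule summable_on_comparison_test) (use n in auto)
  have "(\<Sum>\<^sub>\<infinity>i. norm (\<Sum>\<^sub>\<infinity>x\<in>S i. f x)) \<le> (\<Sum>\<^sub>\<infinity>i. \<Sum>\<^sub>\<infinity>x\<in>S i. norm (f x))"
    by (rule infsum_mono[OF s2 s1 n])
  also have "\<dots> = (\<Sum>\<^sub>\<infinity>z\<in>Sigma UNIV S. norm (f (snd z)))"
    using infsum_Sigma'_banach[of "\<lambda>i x. norm (f x)" UNIV S] s by (simp add: case_prod_unfold)
  also have "\<dots> = (\<Sum>\<^sub>\<infinity>x\<in>snd ` Sigma UNIV S. norm (f x))"
    by (simp add: infsum_reindex[OF inj] o_def)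
  also have "\<dots> \<le> (\<Sum>\<^sub>\<infinity>x. norm (f x))"
    by (rule infsum_mono_neutral[OF fs f]) auto
  finally show "(\<Sum>\<^sub>\<infinity>i. norm (\<Sum>\<^sub>\<infinity>x\<in>S i. f x)) \<le> (\<Sum>\<^sub>\<infinity>x. norm (f x))" .
qed

lemma cubic_coeff_abs_summable:
  assumes a: "(\<lambda>n. norm (a n)) summable_on UNIV"
  shows "(\<lambda>n. norm (cubic_coeff a n)) summable_on UNIV"
  unfolding cubic_coeff_def
  by (rule abs_summable_fibres[OF cubic_term_abs_summable[OF a]]) auto

lemma abs_summable_Suc:
  fixes a :: "nat \<Rightarrow> complex"
  assumes a: "(\<lambda>n. norm (a n)) summable_on UNIV"
  shows "(\<lambda>n. norm (a (Suc n))) summable_on UNIV"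
    and "(\<Sum>\<^sub>\<infinity>n. norm (a (Suc n))) \<le> (\<Sum>\<^sub>\<infinity>n. norm (a n))"
proof -
  have s: "(\<lambda>n. norm (a n)) summable_on range Suc"
    using summable_on_subset_banach[OF a] by auto
  then show "(\<lambda>n. norm (a (Suc n))) summable_on UNIV"
    using summable_on_reindex[of Suc UNIV "\<lambda>n. norm (a n)"] by (simp add: o_def)
  have "(\<Sum>\<^sub>\<infinity>n. norm (a (Suc n))) = (\<Sum>\<^sub>\<infinity>n\<in>range Suc. norm (a n))"
    using infsum_reindex[of Suc UNIV "\<lambda>n. norm (a n)"] by (simp add: o_def)
  also have "\<dots> \<le> (\<Sum>\<^sub>\<infinity>n. norm (a n))"
    by (rule infsum_mono_neutral[OF s a]) auto
  finally show "(\<Sum>\<^sub>\<infinity>n. norm (a (Suc n))) \<le> (\<Sum>\<^sub>\<infinity>n. norm (a n))" .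
qed

lemma norm_le_infsum_norm:
  fixes a :: "nat \<Rightarrow> complex"
  assumes "(\<lambda>n. norm (a n)) summable_on UNIV"
  shows "norm (a n) \<le> (\<Sum>\<^sub>\<infinity>n. norm (a n))"
  using finite_sum_le_infsum[OF assms, of "{n}"] by simp

section \<open>Factoring the cubic convolution through Toeplitz and Hankel matrices\<close>

definition pair_term :: "(nat \<Rightarrow> complex) \<Rightarrow> nat \<times> nat \<Rightarrow> complex" where
  "pair_term a = (\<lambda>(l, p). a l * cnj (a p))"

text \<open>The constraint reads \<open>l' - p = j - l\<close>: this is the Fourier coefficient of
  index \<open>j - l\<close> of |u|^2, so the matrix is that of the Toeplitz operator with symbol
  |u|^2.\<close>

definition toeplitz_entry :: "(nat \<Rightarrow> complex) \<Rightarrow> nat \<Rightarrow> nat \<Rightarrow> complex" where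
  "toeplitz_entry a j l = (\<Sum>\<^sub>\<infinity>x\<in>{(l', p). l' + l = p + j}. pair_term a x)"

text \<open>The omitted pairs are \<open>m = k + e + i\<close>, \<open>p = q + e + i\<close> with
  \<open>i \<ge> 0\<close>. Hence this is the Toeplitz matrix of |u|^2 minus H times its adjoint,
  where H is the Hankel matrix with entries \<open>a (i + j + e)\<close>.\<close>

definition truncated_entry :: "nat \<Rightarrow> (nat \<Rightarrow> complex) \<Rightarrow> nat \<Rightarrow> nat \<Rightarrow> complex" where
  "truncated_entry e a k q = (\<Sum>\<^sub>\<infinity>x\<in>{(m, p). q + m = p + k \<and> m < k + e}. pair_term a x)"

lemma pair_term_abs_summable:
  assumes a: "(\<lambda>n. norm (a n)) summable_on UNIV"
  shows "(\<lambda>x. norm (pair_term a x)) summable_on UNIV"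
    and "(\<Sum>\<^sub>\<infinity>x. norm (pair_term a x)) = (\<Sum>\<^sub>\<infinity>n. norm (a n))\<^sup>2"
proof -
  have a': "(\<lambda>n. norm (cnj (a n))) summable_on UNIV" using a by simp
  show "(\<lambda>x. norm (pair_term a x)) summable_on UNIV"
    using abs_summable_prod(1)[OF a a'] by (simp add: pair_term_def case_prod_beta)
  show "(\<Sum>\<^sub>\<infinity>x. norm (pair_term a x)) = (\<Sum>\<^sub>\<infinity>n. norm (a n))\<^sup>2"
    using abs_summable_prod(3)[OF a a'] by (simp add: pair_term_def case_prod_beta power2_eq_square)
qed

lemma toeplitz_entry_bound:
  assumes a: "(\<lambda>n. norm (a n)) summable_on UNIV"
  shows "(\<lambda>l. norm (toeplitz_entry a j l)) summable_on UNIV"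
    and "(\<Sum>\<^sub>\<infinity>l. norm (toeplitz_entry a j l)) \<le> (\<Sum>\<^sub>\<infinity>n. norm (a n))\<^sup>2"
  unfolding toeplitz_entry_def pair_term_abs_summable(2)[OF a, symmetric]
  by (rule abs_summable_fibres[OF pair_term_abs_summable(1)[OF a]]; auto)+

lemma truncated_entry_bound:
  assumes a: "(\<lambda>n. norm (a n)) summable_on UNIV"
  shows "(\<lambda>q. norm (truncated_entry e a k q)) summable_on UNIV"
    and "(\<Sum>\<^sub>\<infinity>q. norm (truncated_entry e a k q)) \<le> (\<Sum>\<^sub>\<infinity>n. norm (a n))\<^sup>2"
  unfolding truncated_entry_def pair_term_abs_summable(2)[OF a, symmetric]
  by (rule abs_summable_fibres[OF pair_term_abs_summable(1)[OF a]]; auto)+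

text \<open>
  The triples with \<open>m \<ge> k + e\<close> give the first sum. In the others, the cubic term factors through
  \<open>a (j + q + e)\<close> with \<open>q = p + k - m\<close>, and \<open>e \<le> 1\<close> is what makes this \<open>q\<close> nonnegative.
\<close>
lemma cubic_coeff_split:
  assumes a: "(\<lambda>n. norm (a n)) summable_on UNIV" and e: "e \<le> 1"
  shows "cubic_coeff a (j + k + e) =
    (\<Sum>\<^sub>\<infinity>l. toeplitz_entry a j l * a (l + k + e)) + (\<Sum>\<^sub>\<infinity>q. truncated_entry e a k q * a (j + q + e))"
proof -
  have s: "cubic_term a summable_on S" for S
    using summable_on_subset_banach[OF abs_summable_summable[OF cubic_term_abs_summable[OF a]]] by auto
  define S1 where "S1 = {(l, p, m). l + m = p + (j + k + e) \<and> k + e \<le> m}"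
  define S2 where "S2 = {(l, p, m). l + m = p + (j + k + e) \<and> m < k + e}"
  define Q1 where "Q1 = (SIGMA l:UNIV. {(l', p). l' + l = p + j})"
  define Q2 where "Q2 = (SIGMA q:UNIV. {(m, p). q + m = p + k \<and> m < k + e})"
  have "{(l, p, m). l + m = p + (j + k + e)} = S1 \<union> S2" by (auto simp: S1_def S2_def)
  then have "cubic_coeff a (j + k + e) = infsum (cubic_term a) S1 + infsum (cubic_term a) S2"
    unfolding cubic_coeff_def by (simp add: infsum_Un_disjoint[OF s s] S1_def S2_def disjoint_iff)
  also have "infsum (cubic_term a) S1 = (\<Sum>\<^sub>\<infinity>l. toeplitz_entry a j l * a (l + k + e))"
  proof -
    have bij: "bij_betw (\<lambda>(l, l', p). (l', p, l + k + e)) Q1 S1"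
      by (rule bij_betw_byWitness[where f' = "\<lambda>(l, p, m). (m - (k + e), l, p)"]) (auto simp: Q1_def S1_def)
    have eq: "cubic_term a ((\<lambda>(l, l', p). (l', p, l + k + e)) x) = (\<lambda>(l, x). pair_term a x * a (l + k + e)) x" for x
      by (auto simp: cubic_term_def pair_term_def split: prod.splits)
    have "(\<lambda>(l, x). pair_term a x * a (l + k + e)) summable_on Q1"
      using summable_on_reindex_bij_betw[OF bij, of "cubic_term a"] s by (simp add: eq)
    then have "infsum (\<lambda>(l, x). pair_term a x * a (l + k + e)) Q1 = (\<Sum>\<^sub>\<infinity>l. toeplitz_entry a j l * a (l + k + e))"
      unfolding Q1_def by (simp add: toeplitz_entry_def infsum_cmult_left' flip: infsum_Sigma'_banach)
    then show ?thesis
      using infsum_reindex_bij_betw[OF bij, of "cubic_term a"] by (simp add: eq)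
  qed
  also have "infsum (cubic_term a) S2 = (\<Sum>\<^sub>\<infinity>q. truncated_entry e a k q * a (j + q + e))"
  proof -
    have bij: "bij_betw (\<lambda>(q, m, p). (j + q + e, p, m)) Q2 S2"
      by (rule bij_betw_byWitness[where f' = "\<lambda>(l, p, m). (p + k - m, m, p)"]) (use e in \<open>auto simp: Q2_def S2_def\<close>)
    have eq: "cubic_term a ((\<lambda>(q, m, p). (j + q + e, p, m)) x) = (\<lambda>(q, x). pair_term a x * a (j + q + e)) x" for x
      by (auto simp: cubic_term_def pair_term_def split: prod.splits)
    have "(\<lambda>(q, x). pair_term a x * a (j + q + e)) summable_on Q2"
      using summable_on_reindex_bij_betw[OF bij, of "cubic_term a"] s by (simp add: eq)
    then have "infsum (\<lambda>(q, x). pair_term a x * a (j + q + e)) Q2 = (\<Sum>\<^sub>\<infinity>q. truncated_entry e a k q * a (j + q + e))"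
      unfolding Q2_def by (simp add: truncated_entry_def infsum_cmult_left' flip: infsum_Sigma'_banach)
    then show ?thesis
      using infsum_reindex_bij_betw[OF bij, of "cubic_term a"] by (simp add: eq)
  qed
  finally show ?thesis .
qed

section \<open>Minors of infinite matrices\<close>

text \<open>Each member is controlled through the supremum of the whole family, so no single scalar
  inequality closes by itself. The hypothesis \<open>bound\<close> speaks of every common bound
  \<open>b\<close> instead of naming the supremum; integrating it against the weighted supremum
  \<open>S\<close> gives \<open>S \<le> S / 2\<close>.\<close>

lemma gronwall_family_zero:
  fixes m m' :: "'i \<Rightarrow> real \<Rightarrow> complex"
  assumes K: "K > 0"
    and deriv: "\<And>i t. t \<in> {0..T} \<Longrightarrow> (m i has_vector_derivative m' i t) (at t)"
    and bounded: "\<And>i t. t \<in> {0..T} \<Longrightarrow> norm (m i t) \<le> R"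
    and bound: "\<And>i t b. t \<in> {0..T} \<Longrightarrow> (\<And>j. norm (m j t) \<le> b) \<Longrightarrow> norm (m' i t) \<le> K * b"
    and zero: "\<And>i. m i 0 = 0"
    and T: "t \<in> {0..T}"
  shows "m i t = 0"
proof -
  \<comment> \<open>the exponential weight makes the integrated estimate a contraction by the factor \<open>1/2\<close>\<close>
  define X where "X = {exp (- 2 * K * t) * norm (m i t) | i t. t \<in> {0..T}}"
  define S where "S = Sup X"
  \<comment> \<open>The constant \<open>R\<close> only makes \<open>S\<close> a genuine supremum; it
    does not enter the contraction.\<close>
  have "bdd_above X"
  proof (rule bdd_aboveI)
    fix x assume "x \<in> X"
    then obtain i t where x: "x = exp (- 2 * K * t) * norm (m i t)" and t: "t \<in> {0..T}"
      by (auto simp: X_def)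
    have "exp (- 2 * K * t) \<le> 1" using K t by simp
    then have "x \<le> 1 * norm (m i t)"
      unfolding x by (intro mult_right_mono) auto
    with bounded[OF t, of i] show "x \<le> R" by simp
  qed
  then have S: "exp (- 2 * K * t) * norm (m i t) \<le> S" if "t \<in> {0..T}" for i t
    unfolding S_def using that by (intro cSup_upper) (auto simp: X_def)
  have S': "norm (m i t) \<le> S * exp (2 * K * t)" if "t \<in> {0..T}" for i t
    using S[OF that, of i] by (simp add: exp_minus field_simps)
  have "0 \<le> norm (m i t) * exp (- 2 * K * t)" by simp
  also have "\<dots> \<le> S" using S[OF T] by (simp add: mult.commute)
  finally have S0: "S \<ge> 0" .
  have half: "exp (- 2 * K * t) * norm (m i t) \<le> S / 2" if t: "t \<in> {0..T}" for i t
  proof (cases "t = 0")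
    case False
    \<comment> \<open>This is an antiderivative of \<open>K * (S * exp (2 * K * x))\<close>, the
      bound on the derivative; the exponent \<open>2 * K\<close> leaves the factor 1/2 after
      integration.\<close>
    define \<phi> where "\<phi> = (\<lambda>x. S / 2 * exp (2 * K * x))"
    have "norm (m i t - m i 0) \<le> \<phi> t - \<phi> 0"
    proof (rule differentiable_bound_general)
      show "0 < t" using False t by simp
      show "continuous_on {0..t} (m i)"
      proof (rule continuous_at_imp_continuous_on, rule ballI)
        fix x assume "x \<in> {0..t}"
        then have "x \<in> {0..T}" using t by auto
        from deriv[OF this] show "isCont (m i) x" by (rule has_vector_derivative_continuous)
      qed
      show "continuous_on {0..t} \<phi>"
        unfolding \<phi>_def by (intro continuous_intros)
      fix x assume x: "0 < x" "x < t"
      then have x': "x \<in> {0..T}" using t by auto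
      show "(m i has_vector_derivative m' i x) (at x)" by (rule deriv[OF x'])
      show "(\<phi> has_vector_derivative K * (S * exp (2 * K * x))) (at x)"
        unfolding \<phi>_def by (auto intro!: derivative_eq_intros simp flip: has_real_derivative_iff_has_vector_derivative)
      show "norm (m' i x) \<le> K * (S * exp (2 * K * x))"
        by (rule bound[OF x' S'[OF x']])
    qed
    also have "\<dots> \<le> \<phi> t" using S0 by (simp add: \<phi>_def)
    finally have "norm (m i t) \<le> \<phi> t" by (simp add: zero)
    then show ?thesis by (simp add: \<phi>_def exp_minus field_simps)
  qed (simp add: zero S0)
  have "S \<le> S / 2"
    unfolding S_def
  proof (rule cSup_least)
    show "X \<noteq> {}" using T by (auto simp: X_def)
  qed (use half in \<open>auto simp: X_def S_def\<close>)
  then have "S = 0" using S0 by simp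
  then show ?thesis using S'[OF T, of i] by simp
qed

lemma has_sum_finite_sum:
  fixes f :: "'i \<Rightarrow> 'a \<Rightarrow> 'b::topological_comm_monoid_add"
  assumes "finite P" "\<And>p. p \<in> P \<Longrightarrow> (f p has_sum S p) A"
  shows "((\<lambda>x. \<Sum>p\<in>P. f p x) has_sum (\<Sum>p\<in>P. S p)) A"
  using assms by (induction P) (auto intro: has_sum_add)

text \<open>The index maps are arbitrary, neither monotone nor injective, so that replacing one row
  index by any \<open>l\<close> gives a minor again; a repeated index merely gives zero.\<close>

definition minor :: "nat \<Rightarrow> (nat \<Rightarrow> nat \<Rightarrow> complex) \<Rightarrow> (nat \<Rightarrow> nat) \<Rightarrow> (nat \<Rightarrow> nat) \<Rightarrow> complex" where
  "minor n M I J = Determinant.det (Matrix.mat n n (\<lambda>(i, j). M (I i) (J j)))"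

lemma minor_leibniz:
  "minor n M I J = (\<Sum>p | p permutes {0..<n}. signof p * (\<Prod>i\<in>{0..<n}. M (I i) (J (p i))))"
  unfolding minor_def Determinant.det_def
  by (auto intro!: sum.cong prod.cong simp: permutes_in_image)

lemma minor_transpose: "minor n M I J = minor n (\<lambda>i j. M j i) J I"
  unfolding minor_def
  by (subst Determinant.det_transpose[symmetric, where n=n])
     (auto intro!: arg_cong[where f=Determinant.det] eq_matI)

text \<open>The directional derivative of the minor at \<open>M\<close> along \<open>X\<close>, that
  is the Leibniz sum with one factor at a time taken from \<open>X\<close>.\<close>

definition minor_diff :: "nat \<Rightarrow> (nat \<Rightarrow> nat \<Rightarrow> complex) \<Rightarrow> (nat \<Rightarrow> nat \<Rightarrow> complex) \<Rightarrow>
    (nat \<Rightarrow> nat) \<Rightarrow> (nat \<Rightarrow> nat) \<Rightarrow> complex" where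
  "minor_diff n M X I J = (\<Sum>p | p permutes {0..<n}. signof p *
     (\<Sum>a\<in>{0..<n}. X (I a) (J (p a)) * (\<Prod>i\<in>{0..<n} - {a}. M (I i) (J (p i)))))"

lemma minor_has_derivative:
  assumes "\<And>i j. ((\<lambda>t. G t i j) has_vector_derivative X i j) (at t)"
  shows "((\<lambda>t. minor n (G t) I J) has_vector_derivative minor_diff n (G t) X I J) (at t)"
  unfolding minor_leibniz minor_diff_def
proof (intro has_vector_derivative_sum has_vector_derivative_mult_right)
  fix p assume "p \<in> {p. p permutes {0..<n}}"
  have "((\<lambda>t. \<Prod>i\<in>{0..<n}. G t (I i) (J (p i))) has_derivative
      (\<lambda>y. \<Sum>a\<in>{0..<n}. (y *\<^sub>R X (I a) (J (p a))) * (\<Prod>i\<in>{0..<n} - {a}. G t (I i) (J (p i))))) (at t)"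
    using assms unfolding has_vector_derivative_def by (intro has_derivative_prod) auto
  then show "((\<lambda>t. \<Prod>i\<in>{0..<n}. G t (I i) (J (p i))) has_vector_derivative
      (\<Sum>a\<in>{0..<n}. X (I a) (J (p a)) * (\<Prod>i\<in>{0..<n} - {a}. G t (I i) (J (p i))))) (at t)"
    unfolding has_vector_derivative_def by (simp add: scaleR_sum_right)
qed

lemma minor_diff_add:
  "minor_diff n M (\<lambda>i j. X i j + Y i j) I J = minor_diff n M X I J + minor_diff n M Y I J"
  by (simp add: minor_diff_def sum.distrib distrib_left distrib_right)

lemma minor_diff_transpose:
  "minor_diff n M X I J = minor_diff n (\<lambda>i j. M j i) (\<lambda>i j. X j i) J I"
proof -
  \<comment> \<open>both sides are the derivative at 0 of the same minor of \<open>M + t X\<close>\<close>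
  define G where "G = (\<lambda>t::real. \<lambda>i j. M i j + t *\<^sub>R X i j)"
  have G: "((\<lambda>t. G t i j) has_vector_derivative X i j) (at 0)" for i j
    unfolding G_def by (auto intro!: derivative_eq_intros)
  have 1: "((\<lambda>t. minor n (G t) I J) has_vector_derivative minor_diff n (G 0) X I J) (at 0)"
    by (rule minor_has_derivative[OF G])
  have 2: "((\<lambda>t. minor n (\<lambda>i j. G t j i) J I) has_vector_derivative minor_diff n (\<lambda>i j. G 0 j i) (\<lambda>i j. X j i) J I) (at 0)"
    by (rule minor_has_derivative[OF G])
  have "minor_diff n (G 0) X I J = minor_diff n (\<lambda>i j. G 0 j i) (\<lambda>i j. X j i) J I"
    using vector_derivative_unique_at[OF 1] 2 by (simp add: minor_transpose[of n _ I J])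
  then show ?thesis by (simp add: G_def)
qed

text \<open>Row \<open>i\<close> of \<open>X\<close> is the combination of the rows of
  \<open>M\<close> with weights \<open>A i l\<close>. By multilinearity, the part of the derivative
  that varies row \<open>a\<close> is the combination, with weights \<open>A (I a) l\<close>, of the
  minors whose row index \<open>I a\<close> is replaced by \<open>l\<close>. Each of the
  \<open>n\<close> rows thus contributes at most \<open>K * b\<close>.\<close>

lemma minor_diff_row_bound:
  assumes X: "\<And>i k. ((\<lambda>l. A i l * M l k) has_sum X i k) UNIV"
    and A: "\<And>i. (\<lambda>l. norm (A i l)) summable_on UNIV" "\<And>i. (\<Sum>\<^sub>\<infinity>l. norm (A i l)) \<le> K"
    and b: "\<And>I. norm (minor n M I J) \<le> b"
  shows "norm (minor_diff n M X I J) \<le> real n * (K * b)"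
proof -
  have "minor_diff n M X I J = (\<Sum>a\<in>{0..<n}. \<Sum>p | p permutes {0..<n}. signof p * (X (I a) (J (p a)) * (\<Prod>i\<in>{0..<n} - {a}. M (I i) (J (p i)))))"
    unfolding minor_diff_def sum_distrib_left by (rule sum.swap)
  also have "norm \<dots> \<le> (\<Sum>a\<in>{0..<n}. K * b)"
  proof (rule sum_norm_le)
    fix a assume a: "a \<in> {0..<n}"
    have "((\<lambda>l. \<Sum>p | p permutes {0..<n}. signof p * ((A (I a) l * M l (J (p a))) * (\<Prod>i\<in>{0..<n} - {a}. M (I i) (J (p i))))) has_sum
       (\<Sum>p | p permutes {0..<n}. signof p * (X (I a) (J (p a)) * (\<Prod>i\<in>{0..<n} - {a}. M (I i) (J (p i)))))) UNIV"
      by (intro has_sum_finite_sum finite_permutations finite_atLeastLessThan has_sum_cmult_right has_sum_cmult_left X)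
    also have "(\<lambda>l. \<Sum>p | p permutes {0..<n}. signof p * ((A (I a) l * M l (J (p a))) * (\<Prod>i\<in>{0..<n} - {a}. M (I i) (J (p i)))))
       = (\<lambda>l. A (I a) l * minor n M (I(a := l)) J)"
    proof
      fix l
      have "M l (J (p a)) * (\<Prod>i\<in>{0..<n} - {a}. M (I i) (J (p i))) = (\<Prod>i\<in>{0..<n}. M ((I(a := l)) i) (J (p i)))" for p
        using a by (subst (2) prod.remove[of _ a]) auto
      then show "(\<Sum>p | p permutes {0..<n}. signof p * ((A (I a) l * M l (J (p a))) * (\<Prod>i\<in>{0..<n} - {a}. M (I i) (J (p i)))))
        = A (I a) l * minor n M (I(a := l)) J"
        unfolding minor_leibniz sum_distrib_left by (intro sum.cong) (simp_all add: mult_ac)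
    qed
    finally have hs: "((\<lambda>l. A (I a) l * minor n M (I(a := l)) J) has_sum
       (\<Sum>p | p permutes {0..<n}. signof p * (X (I a) (J (p a)) * (\<Prod>i\<in>{0..<n} - {a}. M (I i) (J (p i)))))) UNIV" .
    have le: "norm (A (I a) l * minor n M (I(a := l)) J) \<le> norm (A (I a) l) * b" for l
      using b by (auto simp: norm_mult intro!: mult_left_mono)
    have "norm (\<Sum>p | p permutes {0..<n}. signof p * (X (I a) (J (p a)) * (\<Prod>i\<in>{0..<n} - {a}. M (I i) (J (p i))))) \<le> (\<Sum>\<^sub>\<infinity>l. norm (A (I a) l)) * b"
      by (rule norm_infsum_le[OF hs, of "\<lambda>l. norm (A (I a) l) * b"])
         (use A le in \<open>auto intro!: has_sum_cmult_left has_sum_infsum\<close>)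
    \<comment> \<open>Monotonicity needs \<open>b \<ge> 0\<close>, which any single minor provides;
      \<open>undefined\<close> stands for an arbitrary index map.\<close>
    also have "\<dots> \<le> K * b"
      using A b[of undefined] norm_ge_zero order_trans by (intro mult_right_mono) blast+
    finally show "norm (\<Sum>p | p permutes {0..<n}. signof p * (X (I a) (J (p a)) * (\<Prod>i\<in>{0..<n} - {a}. M (I i) (J (p i))))) \<le> K * b" .
  qed
  finally show ?thesis by simp
qed

text \<open>A crude count of the Leibniz terms. Its purpose is a bound uniform in the index maps, so
  that the supremum in the Gronwall argument is finite.\<close>

lemma minor_norm_le:
  assumes "\<And>i j. norm (M i j) \<le> R"
  shows "norm (minor n M I J) \<le> fact n * R ^ n"
proof -
  have "norm (minor n M I J) \<le> (\<Sum>p | p permutes {0..<n}. R ^ n)"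
    unfolding minor_leibniz
  proof (rule sum_norm_le)
    fix p
    have "norm (signof p * (\<Prod>i\<in>{0..<n}. M (I i) (J (p i)))) = (\<Prod>i\<in>{0..<n}. norm (M (I i) (J (p i))))"
      by (simp add: norm_mult prod_norm sign_def)
    also have "\<dots> \<le> (\<Prod>i\<in>{0..<n}. R)"
      by (rule prod_mono) (use assms in auto)
    finally show "norm (signof p * (\<Prod>i\<in>{0..<n}. M (I i) (J (p i)))) \<le> R ^ n" by simp
  qed
  then show ?thesis by (simp add: card_permutations)
qed

lemma minors_zero_propagate_forward:
  fixes G G' :: "real \<Rightarrow> nat \<Rightarrow> nat \<Rightarrow> complex"
  assumes deriv: "\<And>t i j. t \<in> {0..T} \<Longrightarrow> ((\<lambda>t. G t i j) has_vector_derivative X t i j + Y t i j) (at t)"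
    and X: "\<And>t i j. t \<in> {0..T} \<Longrightarrow> ((\<lambda>l. A t i l * G t l j) has_sum X t i j) UNIV"
    and Y: "\<And>t i j. t \<in> {0..T} \<Longrightarrow> ((\<lambda>l. B t j l * G t i l) has_sum Y t i j) UNIV"
    and A: "\<And>t i. t \<in> {0..T} \<Longrightarrow> (\<lambda>l. norm (A t i l)) summable_on UNIV"
      "\<And>t i. t \<in> {0..T} \<Longrightarrow> (\<Sum>\<^sub>\<infinity>l. norm (A t i l)) \<le> K"
    and B: "\<And>t i. t \<in> {0..T} \<Longrightarrow> (\<lambda>l. norm (B t i l)) summable_on UNIV"
      "\<And>t i. t \<in> {0..T} \<Longrightarrow> (\<Sum>\<^sub>\<infinity>l. norm (B t i l)) \<le> K"
    and R: "\<And>t i j. t \<in> {0..T} \<Longrightarrow> norm (G t i j) \<le> R"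
    and zero: "\<And>I J. minor n (G 0) I J = 0"
    and t: "t \<in> {0..T}"
  shows "minor n (G t) I J = 0"
proof -
  have K: "K \<ge> 0" using A(2)[OF t, of 0] infsum_nonneg[of UNIV "\<lambda>l. norm (A t 0 l)"] by auto
  \<comment> \<open>The family is indexed by pairs of index maps. Rows and columns each contribute
    \<open>real n * K\<close> to the Gronwall constant, and the added 1 keeps it positive when
    \<open>n\<close> or \<open>K\<close> is zero.\<close>
  have "(case (I, J) of (I, J) \<Rightarrow> (\<lambda>t. minor n (G t) I J)) t = 0"
  proof (rule gronwall_family_zero[where K = "2 * real n * K + 1" and T = T and R = "fact n * R ^ n"
        and m = "\<lambda>(I, J) t. minor n (G t) I J" and m' = "\<lambda>(I, J) t. minor_diff n (G t) (\<lambda>i j. X t i j + Y t i j) I J"])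
    fix t and IJ :: "(nat \<Rightarrow> nat) \<times> (nat \<Rightarrow> nat)" and b
    assume t: "t \<in> {0..T}" and b: "\<And>IJ. norm ((case IJ of (I, J) \<Rightarrow> (\<lambda>t. minor n (G t) I J)) t) \<le> b"
    obtain I J where IJ: "IJ = (I, J)" by force
    have b': "norm (minor n (G t) I J) \<le> b" for I J using b[of "(I, J)"] by simp
    then have "b \<ge> 0" using norm_ge_zero order_trans by blast
    have "norm (minor_diff n (G t) (X t) I J) \<le> real n * (K * b)"
      by (rule minor_diff_row_bound[OF X[OF t] A[OF t] b'])
    \<comment> \<open>\<open>Y\<close> combines columns of \<open>G t\<close>; after transposition
      it combines rows, and the row estimate applies with \<open>B\<close>.\<close>
    moreover have "norm (minor_diff n (G t) (Y t) I J) \<le> real n * (K * b)"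
      unfolding minor_diff_transpose[of n "G t"]
      by (rule minor_diff_row_bound[OF Y[OF t] B[OF t]]) (use b' minor_transpose in metis)
    ultimately have "norm (minor_diff n (G t) (\<lambda>i j. X t i j + Y t i j) I J) \<le> real n * (K * b) + real n * (K * b)"
      unfolding minor_diff_add by (rule norm_triangle_mono)
    also have "\<dots> \<le> (2 * real n * K + 1) * b" using \<open>b \<ge> 0\<close> by (simp add: algebra_simps)
    finally show "norm ((case IJ of (I, J) \<Rightarrow> (\<lambda>t. minor_diff n (G t) (\<lambda>i j. X t i j + Y t i j) I J)) t) \<le> (2 * real n * K + 1) * b"
      by (simp add: IJ)
  next
    show "0 < 2 * real n * K + 1" using K by (simp add: add_nonneg_pos)
  qed (use t deriv R zero in \<open>auto intro: minor_has_derivative minor_norm_le\<close>)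
  then show ?thesis by simp
qed

text \<open>Backward propagation is forward propagation for the time-reversed path. The sign of the
  time change is absorbed into \<open>A\<close> and \<open>B\<close>, whose row sums it leaves
  unchanged.\<close>

lemma minors_zero_propagate:
  fixes G X Y :: "real \<Rightarrow> nat \<Rightarrow> nat \<Rightarrow> complex"
  assumes deriv: "\<And>t i j. ((\<lambda>t. G t i j) has_vector_derivative X t i j + Y t i j) (at t)"
    and X: "\<And>t i j. ((\<lambda>l. A t i l * G t l j) has_sum X t i j) UNIV"
    and Y: "\<And>t i j. ((\<lambda>l. B t j l * G t i l) has_sum Y t i j) UNIV"
    and A: "\<And>t i. (\<lambda>l. norm (A t i l)) summable_on UNIV"
    and B: "\<And>t i. (\<lambda>l. norm (B t i l)) summable_on UNIV"
    and KA: "\<And>t i. t \<in> closed_segment t0 t1 \<Longrightarrow> (\<Sum>\<^sub>\<infinity>l. norm (A t i l)) \<le> K"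
    and KB: "\<And>t i. t \<in> closed_segment t0 t1 \<Longrightarrow> (\<Sum>\<^sub>\<infinity>l. norm (B t i l)) \<le> K"
    and R: "\<And>t i j. t \<in> closed_segment t0 t1 \<Longrightarrow> norm (G t i j) \<le> R"
    and zero: "\<And>I J. minor n (G t0) I J = 0"
  shows "minor n (G t1) I J = 0"
proof -
  define \<sigma> :: real where "\<sigma> = (if t0 \<le> t1 then 1 else -1)"
  define p where "p = (\<lambda>t. t0 + \<sigma> * t)"
  have seg: "p t \<in> closed_segment t0 t1" if "t \<in> {0..\<bar>t1 - t0\<bar>}" for t
    using that by (auto simp: p_def \<sigma>_def closed_segment_eq_real_ivl)
  have p1: "p \<bar>t1 - t0\<bar> = t1" by (auto simp: p_def \<sigma>_def)
  have n\<sigma>: "norm (complex_of_real \<sigma>) = 1" by (simp add: \<sigma>_def)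
  have "minor n (G (p \<bar>t1 - t0\<bar>)) I J = 0"
  proof (rule minors_zero_propagate_forward[where G = "\<lambda>t. G (p t)" and T = "\<bar>t1 - t0\<bar>" and K = K and R = R
        and X = "\<lambda>t i j. of_real \<sigma> * X (p t) i j" and Y = "\<lambda>t i j. of_real \<sigma> * Y (p t) i j"
        and A = "\<lambda>t i l. of_real \<sigma> * A (p t) i l" and B = "\<lambda>t i l. of_real \<sigma> * B (p t) i l"])
    fix t i j
    have "(p has_vector_derivative \<sigma>) (at t)"
      unfolding p_def by (auto intro!: derivative_eq_intros simp flip: has_real_derivative_iff_has_vector_derivative)
    from vector_diff_chain_at[OF this deriv]
    show "((\<lambda>t. G (p t) i j) has_vector_derivative of_real \<sigma> * X (p t) i j + of_real \<sigma> * Y (p t) i j) (at t)"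
      by (simp add: o_def scaleR_conv_of_real distrib_left)
    show "((\<lambda>l. of_real \<sigma> * A (p t) i l * G (p t) l j) has_sum of_real \<sigma> * X (p t) i j) UNIV"
      unfolding mult.assoc by (intro has_sum_cmult_right X)
    show "((\<lambda>l. of_real \<sigma> * B (p t) j l * G (p t) i l) has_sum of_real \<sigma> * Y (p t) i j) UNIV"
      unfolding mult.assoc by (intro has_sum_cmult_right Y)
  next
    show "minor n (G (p 0)) I J = 0" for I J using zero by (simp add: p_def)
  qed (use A B KA KB R seg n\<sigma> in \<open>simp_all add: norm_mult\<close>)
  then show ?thesis by (simp add: p1)
qed

section \<open>Kronecker's theorem\<close>

text \<open>Finitely many rows with infinitely many columns: in a largest leading block of rows with
  a nonzero minor, bordering that minor by one more row and an arbitrary column \<open>k\<close>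
  gives a vanishing determinant, whose expansion along column \<open>k\<close> is the
  relation.\<close>

lemma row_dependence_of_minors:
  assumes "\<And>J. minor n M id J = 0"
  shows "\<exists>c. (\<exists>i<n. c i \<noteq> 0) \<and> (\<forall>k. (\<Sum>i<n. c i * M i k) = 0)"
  using assms
proof (induction n)
  case 0
  then show ?case by (simp add: minor_def)
next
  case (Suc n)
  show ?case
  proof (cases "\<forall>J. minor n M id J = 0")
    case True
    then obtain c i where c: "i < n" "c i \<noteq> 0" "\<And>k. (\<Sum>i<n. c i * M i k) = 0"
      using Suc.IH by blast
    have "(\<Sum>i<n. (c(n := 0)) i * M i k) = (\<Sum>i<n. c i * M i k)" for k
      by (rule sum.cong) auto
    then show ?thesis
      using c by (intro exI[of _ "c(n := 0)"]) (auto intro!: exI[of _ i])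
  next
    case False
    then obtain J where J: "minor n M id J \<noteq> 0" by blast
    \<comment> \<open>cofactors along the last column do not depend on the column index \<open>k\<close> put there\<close>
    define A where "A = (\<lambda>k. Matrix.mat (Suc n) (Suc n) (\<lambda>(i, j). M i (if j < n then J j else k)))"
    define c where "c = (\<lambda>i. Determinant.cofactor (A 0) i n)"
    have md: "mat_delete (A k) i n = mat_delete (A 0) i n" for k i
      unfolding mat_delete_def by (rule eq_matI) (auto simp: A_def)
    then have c_k: "Determinant.cofactor (A k) i n = c i" for k i
      by (simp only: c_def Determinant.cofactor_def md[of k i])
    have "(\<Sum>i<Suc n. c i * M i k) = 0" for k
    proof -
      have "Determinant.det (A k) = minor (Suc n) M id (\<lambda>j. if j < n then J j else k)"
        by (simp add: minor_def A_def)
      then have "0 = Determinant.det (A k)" using Suc.prems by simp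
      also have "\<dots> = (\<Sum>i<Suc n. A k $$ (i, n) * Determinant.cofactor (A k) i n)"
        by (rule laplace_expansion_column) (auto simp: A_def)
      also have "\<dots> = (\<Sum>i<Suc n. c i * M i k)"
        unfolding c_k by (rule sum.cong) (auto simp: A_def)
      finally show ?thesis by simp
    qed
    \<comment> \<open>The last cofactor is the nonzero minor chosen above, so the relation is
      nontrivial.\<close>
    moreover have "c n \<noteq> 0"
    proof -
      have "mat_delete (A 0) n n = Matrix.mat n n (\<lambda>(i, j). M (id i) (J j))"
        unfolding mat_delete_def by (rule eq_matI) (auto simp: A_def)
      then show ?thesis using J by (simp add: c_def Determinant.cofactor_def minor_def)
    qed
    ultimately show ?thesis by (intro exI[of _ c]) auto
  qed
qed

text \<open>The selected block factors through a space of dimension \<open>r\<close>. Padding the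
  first factor with a zero column keeps both factors square, so that the determinant is
  multiplicative; row \<open>r\<close> of the second factor meets only that column.\<close>

lemma minor_zero_of_row_span:
  assumes M: "\<And>i k. M i k = (\<Sum>l<r. x i l * M l k)"
  shows "minor (Suc r) M I J = 0"
proof -
  define A where "A = Matrix.mat (Suc r) (Suc r) (\<lambda>(i, j). if j < r then x (I i) j else 0)"
  define B where "B = Matrix.mat (Suc r) (Suc r) (\<lambda>(i, j). M i (J j))"
  have c: "A \<in> carrier_mat (Suc r) (Suc r)" "B \<in> carrier_mat (Suc r) (Suc r)"
    by (auto simp: A_def B_def)
  have "Determinant.det A = (\<Sum>i<Suc r. A $$ (i, r) * Determinant.cofactor A i r)"
    by (rule laplace_expansion_column[OF c(1)]) simp
  also have "\<dots> = 0" by (rule sum.neutral) (simp add: A_def)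
  finally have A0: "Determinant.det A = 0" .
  have "Matrix.mat (Suc r) (Suc r) (\<lambda>(i, j). M (I i) (J j)) = A * B"
  proof (rule eq_matI)
    fix i j assume "i < dim_row (A * B)" "j < dim_col (A * B)"
    then have ij: "i < Suc r" "j < Suc r" by (auto simp: A_def B_def)
    have "(A * B) $$ (i, j) = (\<Sum>l = 0..<Suc r. A $$ (i, l) * B $$ (l, j))"
      using ij c by (simp add: scalar_prod_def)
    also have "\<dots> = (\<Sum>l<r. x (I i) l * M l (J j))"
      using ij by (simp add: A_def B_def lessThan_atLeast0)
    finally show "Matrix.mat (Suc r) (Suc r) (\<lambda>(i, j). M (I i) (J j)) $$ (i, j) = (A * B) $$ (i, j)"
      using ij M[of "I i" "J j"] by simp
  qed (auto simp: A_def B_def)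
  then show ?thesis by (simp add: minor_def Determinant.det_mult[OF c] A0)
qed

text \<open>The offset 1 leaves out the constant coefficient: this is the Hankel matrix of (u(z) -
  u(0)) / z.\<close>

definition hankel :: "(nat \<Rightarrow> complex) \<Rightarrow> nat \<Rightarrow> nat \<Rightarrow> complex" where
  "hankel a j k = a (j + k + 1)"

text \<open>Above degree \<open>r\<close> the identity B u = A becomes a linear recurrence of length
  \<open>r\<close>. By the offset in \<open>hankel\<close>, every row \<open>i \<ge> r\<close>
  contains only coefficients of index greater than \<open>r\<close>, so it is a combination of the
  \<open>r\<close> rows before it and, by induction, of the first \<open>r\<close> rows.\<close>

lemma hankel_minor_zero_of_rational:
  assumes eq: "fps_of_poly B * Abs_fps a = fps_of_poly A"
    and deg: "degree A \<le> r" "degree B \<le> r" and B0: "coeff B 0 \<noteq> 0"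
  shows "minor (Suc r) (hankel a) I J = 0"
proof -
  have rec: "a n = (\<Sum>m=1..r. - (coeff B m / coeff B 0) * a (n - m))" if n: "n > r" for n
  proof -
    have "0 = fps_nth (fps_of_poly B * Abs_fps a) n"
      using deg(1) n by (simp add: eq coeff_eq_0)
    also have "\<dots> = (\<Sum>m=0..n. coeff B m * a (n - m))"
      by (simp add: fps_mult_nth)
    also have "\<dots> = (\<Sum>m=0..r. coeff B m * a (n - m))"
      using deg(2) n by (intro sum.mono_neutral_right) (auto simp: coeff_eq_0)
    also have "\<dots> = coeff B 0 * a n + (\<Sum>m=1..r. coeff B m * a (n - m))"
      by (simp add: sum.atLeast_Suc_atMost)
    finally have "a n = - (\<Sum>m=1..r. coeff B m * a (n - m)) / coeff B 0"
      using B0 by (simp add: field_simps add_eq_0_iff)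
    also have "\<dots> = (\<Sum>m=1..r. - (coeff B m / coeff B 0) * a (n - m))"
      by (simp add: sum_divide_distrib flip: sum_negf)
    finally show ?thesis .
  qed
  have "\<exists>x. \<forall>k. hankel a i k = (\<Sum>l<r. x l * hankel a l k)" for i
  proof (induction i rule: less_induct)
    case (less i)
    show ?case
    proof (cases "i < r")
      case True
      then show ?thesis
        by (intro exI[of _ "\<lambda>l. if l = i then 1 else 0"]) (simp add: if_distrib[of "\<lambda>x. x * _"] cong: if_cong)
    next
      case False
      have "\<forall>m\<in>{1..r}. \<exists>x. \<forall>k. hankel a (i - m) k = (\<Sum>l<r. x l * hankel a l k)"
        using less False by auto
      then obtain x where x: "\<And>m k. m \<in> {1..r} \<Longrightarrow> hankel a (i - m) k = (\<Sum>l<r. x m l * hankel a l k)"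
        by metis
      have "hankel a i k = (\<Sum>l<r. (\<Sum>m=1..r. - (coeff B m / coeff B 0) * x m l) * hankel a l k)" for k
      proof -
        have "hankel a i k = (\<Sum>m=1..r. - (coeff B m / coeff B 0) * a (i + k + 1 - m))"
          unfolding hankel_def using False by (intro rec) simp
        also have "\<dots> = (\<Sum>m=1..r. - (coeff B m / coeff B 0) * hankel a (i - m) k)"
          using False by (intro sum.cong refl arg_cong2[where f="(*)"]) (auto simp: hankel_def Suc_diff_le)
        also have "\<dots> = (\<Sum>m=1..r. \<Sum>l<r. - (coeff B m / coeff B 0) * x m l * hankel a l k)"
          by (intro sum.cong) (simp_all add: x sum_distrib_left mult.assoc)
        also have "\<dots> = (\<Sum>l<r. (\<Sum>m=1..r. - (coeff B m / coeff B 0) * x m l) * hankel a l k)"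
          unfolding sum_distrib_right by (rule sum.swap)
        finally show ?thesis .
      qed
      then show ?thesis
        by (intro exI[of _ "\<lambda>l. \<Sum>m=1..r. - (coeff B m / coeff B 0) * x m l"] allI)
    qed
  qed
  then obtain x where "\<And>i k. hankel a i k = (\<Sum>l<r. x i l * hankel a l k)"
    by metis
  then show ?thesis by (rule minor_zero_of_row_span)
qed

lemma rational_of_hankel_minor_zero:
  assumes "\<And>I J. minor (Suc r) (hankel a) I J = 0"
  obtains A B where "fps_of_poly B * Abs_fps a = fps_of_poly A" "degree A \<le> r" "degree B \<le> r"
    "B \<noteq> 0"
proof -
  obtain c i0 where c: "i0 < Suc r" "c i0 \<noteq> 0" "\<And>k. (\<Sum>i<Suc r. c i * hankel a i k) = 0"
    using row_dependence_of_minors[of "Suc r" "hankel a"] assms by blast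
  \<comment> \<open>The relation is read backwards because coefficient \<open>m\<close> of
    \<open>B\<close> meets \<open>a (n - m)\<close> in the product, while row \<open>i\<close> of
    the matrix raises the index by \<open>i\<close>. For \<open>n > r\<close> the coefficient of the
    product is then the relation in column \<open>n - r - 1\<close>.\<close>
  define B where "B = Abs_poly (\<lambda>m. if m \<le> r then c (r - m) else 0)"
  have B: "coeff B m = (if m \<le> r then c (r - m) else 0)" for m
    unfolding B_def by (subst Abs_poly_inverse) (auto simp: MOST_nat intro!: exI[of _ r])
  define A where "A = Abs_poly (\<lambda>m. if m \<le> r then fps_nth (fps_of_poly B * Abs_fps a) m else 0)"
  have A: "coeff A m = (if m \<le> r then fps_nth (fps_of_poly B * Abs_fps a) m else 0)" for m
    unfolding A_def by (subst Abs_poly_inverse) (auto simp: MOST_nat intro!: exI[of _ r])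
  show thesis
  proof
    show "degree A \<le> r" "degree B \<le> r"
      by (auto intro!: degree_le simp: A B)
    have "coeff B (r - i0) \<noteq> 0" using c(1,2) by (simp add: B)
    then show "B \<noteq> 0" by auto
    show "fps_of_poly B * Abs_fps a = fps_of_poly A"
    proof (rule fps_ext)
      fix n
      show "fps_nth (fps_of_poly B * Abs_fps a) n = fps_nth (fps_of_poly A) n"
      proof (cases "n \<le> r")
        case False
        have "fps_nth (fps_of_poly B * Abs_fps a) n = (\<Sum>m=0..n. coeff B m * a (n - m))"
          by (simp add: fps_mult_nth)
        also have "\<dots> = (\<Sum>m=0..r. c (r - m) * a (n - m))"
          using False by (intro sum.mono_neutral_cong_right) (auto simp: B)
        also have "\<dots> = (\<Sum>i<Suc r. c i * hankel a i (n - r - 1))"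
          using False
          by (intro sum.reindex_bij_witness[of _ "\<lambda>i. r - i" "\<lambda>m. r - m"]) (auto simp: hankel_def intro!: arg_cong[where f=a])
        finally show ?thesis using c(3) False by (simp add: A)
      qed (simp add: A)
    qed
  qed
qed

text \<open>Power series form an integral domain, so the common factor cancels in the multiplied-out
  identity. Nothing is divided by \<open>B\<close>, which may still vanish at 0.\<close>

lemma coprime_rational:
  fixes A B :: "complex poly"
  assumes "fps_of_poly B * F = fps_of_poly A" "B \<noteq> 0"
  obtains A' B' where "fps_of_poly B' * F = fps_of_poly A'" "B' \<noteq> 0" "coprime A' B'"
    "degree A' \<le> degree A" "degree B' \<le> degree B"
proof -
  define g where "g = gcd A B"
  have g: "g \<noteq> 0" using assms(2) by (simp add: g_def)
  then obtain A' B' where AB: "A = A' * g" "B = B' * g" "coprime A' B'"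
    using gcd_coprime_exists[of A B] unfolding g_def by blast
  have "fps_of_poly g * (fps_of_poly B' * F) = fps_of_poly g * fps_of_poly A'"
    using assms(1) by (simp add: AB fps_of_poly_mult mult_ac)
  then have eq: "fps_of_poly B' * F = fps_of_poly A'"
    using g by (simp add: fps_of_poly_eq_iff flip: fps_of_poly_0)
  have deg: "degree p \<le> degree (p * g)" for p
    using g by (cases "p = 0") (simp_all add: degree_mult_eq)
  show thesis
    by (rule that[OF eq _ AB(3)]) (use assms(2) AB deg in auto)
qed

text \<open>Absolute summability lets the Cauchy product be evaluated on the boundary circle as
  well, which is needed to exclude zeros of the denominator there.\<close>

lemma poly_times_power_series_closed_disc:
  fixes a :: "nat \<Rightarrow> complex"
  assumes a: "summable (\<lambda>n. norm (a n))" and z: "norm z \<le> 1"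
    and eq: "fps_of_poly B * Abs_fps a = fps_of_poly A"
  shows "poly B z * (\<Sum>n. a n * z ^ n) = poly A z"
proof -
  have poly_sums: "(\<lambda>n. coeff P n * z ^ n) sums poly P z" for P
    using sums_finite[of "{..degree P}" "\<lambda>n. coeff P n * z ^ n"] by (auto simp: poly_altdef coeff_eq_0)
  have 1: "summable (\<lambda>n. norm (coeff B n * z ^ n))"
    by (rule summable_finite[of "{..degree B}"]) (auto simp: coeff_eq_0)
  have 2: "summable (\<lambda>n. norm (a n * z ^ n))"
  proof (rule summable_comparison_test'[OF a])
    show "norm (norm (a n * z ^ n)) \<le> norm (a n)" for n
      using z by (simp add: norm_mult norm_power power_le_one mult_left_le)
  qed
  have "poly B z * (\<Sum>n. a n * z ^ n) = (\<Sum>n. coeff B n * z ^ n) * (\<Sum>n. a n * z ^ n)"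
    using poly_sums[of B] by (simp add: sums_iff)
  also have "\<dots> = (\<Sum>k. \<Sum>i\<le>k. (coeff B i * z ^ i) * (a (k - i) * z ^ (k - i)))"
    by (rule Cauchy_product[OF 1 2])
  also have "\<dots> = (\<Sum>k. coeff A k * z ^ k)"
  proof (rule suminf_cong)
    fix k
    have "coeff A k = fps_nth (fps_of_poly B * Abs_fps a) k" by (simp add: eq)
    also have "\<dots> * z ^ k = (\<Sum>i\<le>k. (coeff B i * z ^ i) * (a (k - i) * z ^ (k - i)))"
      unfolding fps_mult_nth sum_distrib_right atMost_atLeast0
      by (intro sum.cong) (simp_all add: mult_ac flip: power_add)
    finally show "(\<Sum>i\<le>k. (coeff B i * z ^ i) * (a (k - i) * z ^ (k - i))) = coeff A k * z ^ k" by simp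
  qed
  also have "\<dots> = poly A z" using poly_sums[of A] by (simp add: sums_iff)
  finally show ?thesis .
qed

lemma fps_of_rational_on_disc:
  fixes a :: "nat \<Rightarrow> complex"
  assumes a: "summable (\<lambda>n. norm (a n))"
    and eq: "\<And>z. z \<in> ball 0 1 \<Longrightarrow> poly B z \<noteq> 0 \<and> (\<Sum>n. a n * z ^ n) = poly A z / poly B z"
  shows "fps_of_poly B * Abs_fps a = fps_of_poly A"
proof -
  have "summable (\<lambda>n. fps_nth (Abs_fps a) n * 1 ^ n)"
    using summable_norm_cancel[OF a] by simp
  then have "conv_radius (fps_nth (Abs_fps a)) \<ge> ereal (norm (1 :: complex))"
    by (rule conv_radius_geI)
  then have rad: "fps_conv_radius (Abs_fps a) \<ge> 1"
    by (simp add: fps_conv_radius_def one_ereal_def)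
  have rad': "fps_conv_radius (fps_of_poly B * Abs_fps a) \<ge> 1"
    using fps_conv_radius_mult[of "fps_of_poly B" "Abs_fps a"] rad by auto
  show ?thesis
  proof (rule eval_fps_eqD)
    show "fps_conv_radius (fps_of_poly B * Abs_fps a) > 0"
      by (rule less_le_trans[OF _ rad']) simp
    have "eval_fps (fps_of_poly B * Abs_fps a) z = eval_fps (fps_of_poly A) z" if "z \<in> ball 0 1" for z
    proof -
      have "ereal (norm z) < 1" using that by (simp add: one_ereal_def)
      then have "ereal (norm z) < fps_conv_radius (Abs_fps a)" using rad by (rule less_le_trans)
      then have "eval_fps (fps_of_poly B * Abs_fps a) z = poly B z * eval_fps (Abs_fps a) z"
        by (simp add: eval_fps_mult)
      then show ?thesis using eq[OF that] by (simp add: eval_fps_def[of "Abs_fps a"])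
    qed
    then show "\<forall>\<^sub>F z in nhds 0. eval_fps (fps_of_poly B * Abs_fps a) z = eval_fps (fps_of_poly A) z"
      by (intro eventually_nhds_in_open[THEN eventually_mono, of "ball 0 1"]) auto
  qed simp
qed

text \<open>Vanishing minors of size \<open>Suc (Suc r)\<close> bound both degrees by
  \<open>Suc r\<close>, and a nonzero minor of size \<open>Suc r\<close> excludes smaller degrees.
  For the latter, a second fraction A'/B' of the same series with degrees at most \<open>r\<close>
  would satisfy \<open>B dvd B'\<close> and \<open>A dvd A'\<close> by coprimality.\<close>

lemma rational_manifold_iff_hankel_minors:
  assumes f: "f \<in> L2_plus" and sa: "(\<lambda>n. norm (fourier_coeff f (int n))) summable_on UNIV"
  defines "M \<equiv> hankel (\<lambda>n. fourier_coeff f (int n))"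
  shows "f \<in> rational_manifold (Suc r) \<longleftrightarrow>
    (\<forall>I J. minor (Suc (Suc r)) M I J = 0) \<and> \<not> (\<forall>I J. minor (Suc r) M I J = 0)"
proof -
  define a where "a = (\<lambda>n. fourier_coeff f (int n))"
  have M: "M = hankel a" by (simp add: M_def a_def)
  have a: "summable (\<lambda>n. norm (a n))"
    using summable_on_imp_summable[OF sa] by (simp add: a_def)
  have disc: "disc_fun f z = (\<Sum>n. a n * z ^ n)" for z
    by (simp add: disc_fun_def a_def)
  have nz: "poly B z \<noteq> 0" if "z \<in> cball 0 1" "coprime A B" "fps_of_poly B * Abs_fps a = fps_of_poly A" for A B z
  proof
    assume B: "poly B z = 0"
    then have "poly A z = 0"
      using poly_times_power_series_closed_disc[OF a _ that(3), of z] that(1) by simp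
    with B that(2) show False using coprime_poly_0 by blast
  qed
  show ?thesis
  proof
    assume "f \<in> rational_manifold (Suc r)"
    then obtain A B where deg: "degree A \<le> Suc r" "degree B \<le> Suc r" and cop: "coprime A B"
      and max: "degree A = Suc r \<or> degree B = Suc r"
      and B: "\<And>z. z \<in> cball 0 1 \<Longrightarrow> poly B z \<noteq> 0"
      and eqz: "\<And>z. z \<in> ball 0 1 \<Longrightarrow> disc_fun f z = poly A z / poly B z"
      unfolding rational_manifold_def by blast
    have eq: "fps_of_poly B * Abs_fps a = fps_of_poly A"
      by (rule fps_of_rational_on_disc[OF a]) (use B eqz in \<open>auto simp: disc\<close>)
    have "coeff B 0 \<noteq> 0" using B[of 0] by (simp add: poly_0_coeff_0)
    then have "\<forall>I J. minor (Suc (Suc r)) M I J = 0"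
      unfolding M using hankel_minor_zero_of_rational[OF eq deg] by blast
    moreover have False if zero: "\<forall>I J. minor (Suc r) M I J = 0"
    proof -
      obtain A' B' where AB': "fps_of_poly B' * Abs_fps a = fps_of_poly A'" "degree A' \<le> r" "degree B' \<le> r"
        "B' \<noteq> 0"
        by (rule rational_of_hankel_minor_zero[of r a]) (use zero M in auto)
      have "fps_of_poly (A' * B) = fps_of_poly (A * B')"
        unfolding fps_of_poly_mult using eq AB'(1) by (metis mult.assoc mult.commute)
      then have cross: "A' * B = A * B'" by (simp add: fps_of_poly_eq_iff)
      have "B \<noteq> 0" using B[of 0] by auto
      have "B dvd B'"
        using cop cross by (metis coprime_commute coprime_dvd_mult_right_iff dvd_triv_right)
      then have "degree B \<le> r" using AB'(3,4) dvd_imp_degree_le order_trans by blast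
      then have "degree A = Suc r" using max by auto
      \<comment> \<open>Divisibility bounds a degree only below a nonzero multiple, so
        \<open>A' = 0\<close> must be ruled out first.\<close>
      then have "A \<noteq> 0" by auto
      then have "A' \<noteq> 0" using cross AB'(4) by auto
      moreover have "A dvd A'"
        using cop cross by (metis coprime_dvd_mult_left_iff dvd_triv_left)
      ultimately have "degree A \<le> r" using AB'(2) dvd_imp_degree_le order_trans by blast
      then show False using \<open>degree A = Suc r\<close> by simp
    qed
    ultimately show "(\<forall>I J. minor (Suc (Suc r)) M I J = 0) \<and> \<not> (\<forall>I J. minor (Suc r) M I J = 0)"
      by blast
  next
    assume *: "(\<forall>I J. minor (Suc (Suc r)) M I J = 0) \<and> \<not> (\<forall>I J. minor (Suc r) M I J = 0)"
    then have zero: "minor (Suc (Suc r)) (hankel a) I J = 0" for I J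
      using M by simp
    \<comment> \<open>The row relation may produce a \<open>B0\<close> with zeros in the closed
      disc, even at 0; passing to lowest terms removes them.\<close>
    obtain A0 B0 where "fps_of_poly B0 * Abs_fps a = fps_of_poly A0" "degree A0 \<le> Suc r" "degree B0 \<le> Suc r"
        "B0 \<noteq> 0"
      by (rule rational_of_hankel_minor_zero[OF zero])
    then obtain A B where AB: "fps_of_poly B * Abs_fps a = fps_of_poly A" "B \<noteq> 0" "coprime A B"
      "degree A \<le> Suc r" "degree B \<le> Suc r"
      using coprime_rational[of B0 "Abs_fps a" A0] order_trans by metis
    have nzB: "poly B z \<noteq> 0" if "z \<in> cball 0 1" for z
      by (rule nz[OF that AB(3,1)])
    have "degree A = Suc r \<or> degree B = Suc r"
    proof (rule ccontr)
      assume "\<not> ?thesis"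
      then have "degree A \<le> r" "degree B \<le> r" using AB by auto
      moreover have "coeff B 0 \<noteq> 0" using nzB[of 0] by (simp add: poly_0_coeff_0)
      ultimately show False
        using hankel_minor_zero_of_rational[OF AB(1)] * unfolding M by blast
    qed
    moreover have "disc_fun f z = poly A z / poly B z" if "z \<in> ball 0 1" for z
      using poly_times_power_series_closed_disc[OF a _ AB(1), of z] nzB[of z] that
      by (simp add: disc field_simps)
    ultimately show "f \<in> rational_manifold (Suc r)"
      unfolding rational_manifold_def using f AB nzB by blast
  qed
qed

section \<open>Sobolev estimates and the evolution of Fourier coefficients\<close>

text \<open>The Cauchy-Schwarz factor in the embedding of \<open>Hs_plus s\<close> into the Wiener
  algebra; only nonnegative modes are summed.\<close>

definition sobolev_constant :: "real \<Rightarrow> real" where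
  "sobolev_constant s = sqrt (\<Sum>\<^sub>\<infinity>n::nat. (1 + (real n)\<^sup>2) powr (- s))"

lemma summable_sobolev_weights:
  assumes s: "s > 1/2"
  shows "(\<lambda>n::nat. (1 + (real n)\<^sup>2) powr (- s)) summable_on UNIV"
proof -
  have "summable (\<lambda>n. real n powr (- (2 * s)))"
    using s by (subst summable_real_powr_iff) simp
  then have "summable (\<lambda>n::nat. (1 + (real n)\<^sup>2) powr (- s))"
  proof (rule summable_comparison_test'[where N=1])
    fix n :: nat assume n: "1 \<le> n"
    have "(1 + (real n)\<^sup>2) powr (- s) \<le> ((real n)\<^sup>2) powr (- s)"
      using n s by (intro powr_mono2') auto
    also have "(real n)\<^sup>2 = real n powr 2"
      using n by simp
    also have "(real n powr 2) powr (- s) = real n powr (- (2 * s))"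
      by (simp only: powr_powr mult_minus_right)
    finally show "norm ((1 + (real n)\<^sup>2) powr (- s)) \<le> real n powr (- (2 * s))" by simp
  qed
  then show ?thesis by (simp add: summable_on_UNIV_nonneg_real_iff)
qed

text \<open>Cauchy-Schwarz after splitting 1 into the weights with exponents
  \<open>- (s / 2)\<close> and \<open>s / 2\<close>. The estimate is made over finite sets, which
  gives summability and the bound together.\<close>

lemma Hs_plus_wiener:
  assumes s: "s > 1/2" and f: "f \<in> Hs_plus s"
  shows "(\<lambda>n. norm (fourier_coeff f (int n))) summable_on UNIV"
    and "(\<Sum>\<^sub>\<infinity>n. norm (fourier_coeff f (int n))) \<le> sobolev_constant s * Hs_norm s f"
proof -
  have sm: "sobolev_terms s f summable_on UNIV" using f by (simp add: Hs_plus_def Hs_circle_def)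
  have nonneg: "sobolev_terms s f n \<ge> 0" for n by (simp add: sobolev_terms_def)
  have fin: "(\<Sum>n\<in>F. norm (fourier_coeff f (int n))) \<le> sobolev_constant s * Hs_norm s f" if F: "finite F" for F
  proof -
    define a where "a = (\<lambda>n::nat. (1 + (real n)\<^sup>2) powr (- (s / 2)))"
    define b where "b = (\<lambda>n::nat. (1 + (real n)\<^sup>2) powr (s / 2) * norm (fourier_coeff f (int n)))"
    have pos: "1 + (real n)\<^sup>2 > 0" for n by (simp add: add_pos_nonneg)
    have split: "(1 + (real n)\<^sup>2) powr (x + y) = (1 + (real n)\<^sup>2) powr x * (1 + (real n)\<^sup>2) powr y" for x y n
      by (rule powr_add)
    have ab: "norm (fourier_coeff f (int n)) = \<bar>a n\<bar> * \<bar>b n\<bar>" for n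
      using split[of n "- (s / 2)" "s / 2"] pos[of n] by (simp add: a_def b_def abs_mult)
    have a2: "(a n)\<^sup>2 = (1 + (real n)\<^sup>2) powr (- s)" for n
      using split[of n "- (s / 2)" "- (s / 2)"] by (simp add: a_def power2_eq_square)
    have b2: "(b n)\<^sup>2 = sobolev_terms s f (int n)" for n
      using split[of n "s / 2" "s / 2"]
      by (simp add: b_def sobolev_terms_def power_mult_distrib power2_eq_square[of "_ powr _"])
    have "(\<Sum>n\<in>F. norm (fourier_coeff f (int n))) \<le> L2_set a F * L2_set b F"
      unfolding ab by (rule L2_set_mult_ineq)
    also have "L2_set a F \<le> sobolev_constant s"
      unfolding L2_set_def a2 sobolev_constant_def
      by (intro real_sqrt_le_mono finite_sum_le_infsum summable_sobolev_weights s F) auto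
    also have "L2_set b F \<le> Hs_norm s f"
      unfolding L2_set_def b2 Hs_norm_def
    proof (rule real_sqrt_le_mono)
      have "(\<Sum>n\<in>F. sobolev_terms s f (int n)) = sum (sobolev_terms s f) (int ` F)"
        by (simp add: sum.reindex)
      also have "\<dots> \<le> (\<Sum>\<^sub>\<infinity>n. sobolev_terms s f n)"
        by (intro finite_sum_le_infsum sm) (use F nonneg in auto)
      finally show "(\<Sum>n\<in>F. sobolev_terms s f (int n)) \<le> (\<Sum>\<^sub>\<infinity>n. sobolev_terms s f n)" .
    qed
    finally show ?thesis
      by (simp add: mult_right_mono mult_left_mono L2_set_nonneg sobolev_constant_def infsum_nonneg)
  qed
  show sn: "(\<lambda>n. norm (fourier_coeff f (int n))) summable_on UNIV"
    by (rule nonneg_bdd_above_summable_on) (auto intro!: bdd_aboveI2 fin)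
  show "(\<Sum>\<^sub>\<infinity>n. norm (fourier_coeff f (int n))) \<le> sobolev_constant s * Hs_norm s f"
    by (rule infsum_le_finite_sums[OF sn fin])
qed

section \<open>Linear combinations in the Sobolev and Wiener norms\<close>

lemma L2_circle_lincomb:
  assumes f: "f \<in> L2_circle" and g: "g \<in> L2_circle"
  shows "(\<lambda>\<theta>. c * f \<theta> + d * g \<theta>) \<in> L2_circle"
proof -
  have [measurable]: "f \<in> borel_measurable circle" "g \<in> borel_measurable circle"
    using f g by (auto simp: L2_circle_def)
  have "integrable circle (\<lambda>\<theta>. (norm (c * f \<theta> + d * g \<theta>))\<^sup>2)"
  proof (rule Bochner_Integration.integrable_bound)
    show "integrable circle (\<lambda>\<theta>. 2 * ((norm c)\<^sup>2 * (norm (f \<theta>))\<^sup>2) + 2 * ((norm d)\<^sup>2 * (norm (g \<theta>))\<^sup>2))"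
      using f g by (auto simp: L2_circle_def)
    show "(\<lambda>\<theta>. (norm (c * f \<theta> + d * g \<theta>))\<^sup>2) \<in> borel_measurable circle" by measurable
    show "AE \<theta> in circle. norm ((norm (c * f \<theta> + d * g \<theta>))\<^sup>2)
        \<le> norm (2 * ((norm c)\<^sup>2 * (norm (f \<theta>))\<^sup>2) + 2 * ((norm d)\<^sup>2 * (norm (g \<theta>))\<^sup>2))"
    proof (rule AE_I2)
      fix \<theta>
      have "(norm (c * f \<theta> + d * g \<theta>))\<^sup>2 \<le> (norm (c * f \<theta>) + norm (d * g \<theta>))\<^sup>2"
        by (intro power_mono norm_triangle_ineq norm_ge_zero)
      also have "\<dots> \<le> 2 * (norm (c * f \<theta>))\<^sup>2 + 2 * (norm (d * g \<theta>))\<^sup>2"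
        using sum_squares_bound[of "norm (c * f \<theta>)" "norm (d * g \<theta>)"] by (simp add: power2_sum)
      finally show "norm ((norm (c * f \<theta> + d * g \<theta>))\<^sup>2)
        \<le> norm (2 * ((norm c)\<^sup>2 * (norm (f \<theta>))\<^sup>2) + 2 * ((norm d)\<^sup>2 * (norm (g \<theta>))\<^sup>2))"
        by (simp add: norm_mult power_mult_distrib)
    qed
  qed
  then show ?thesis by (simp add: L2_circle_def)
qed

lemma fourier_coeff_lincomb:
  assumes f: "integrable circle f" and g: "integrable circle g"
  shows "fourier_coeff (\<lambda>\<theta>. c * f \<theta> + d * g \<theta>) n = c * fourier_coeff f n + d * fourier_coeff g n"
proof -
  have "integrable circle (\<lambda>\<theta>. c * f \<theta>)" "integrable circle (\<lambda>\<theta>. d * g \<theta>)"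
    using f g by simp_all
  then show ?thesis by (simp add: fourier_coeff_add fourier_coeff_cmult)
qed

lemma Hs_plus_lincomb:
  assumes f: "f \<in> Hs_plus s" and g: "g \<in> Hs_plus s"
  shows "(\<lambda>\<theta>. c * f \<theta> + d * g \<theta>) \<in> Hs_plus s"
proof -
  have f': "f \<in> L2_circle" "\<And>n. n < 0 \<Longrightarrow> fourier_coeff f n = 0" "sobolev_terms s f summable_on UNIV"
    and g': "g \<in> L2_circle" "\<And>n. n < 0 \<Longrightarrow> fourier_coeff g n = 0" "sobolev_terms s g summable_on UNIV"
    using f g by (auto simp: Hs_plus_def Hs_circle_def L2_plus_def)
  note fc = fourier_coeff_lincomb[OF L2_circle_integrable[OF f'(1)] L2_circle_integrable[OF g'(1)], of c d]
  have "sobolev_terms s (\<lambda>\<theta>. c * f \<theta> + d * g \<theta>) summable_on UNIV"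
  proof (rule summable_on_comparison_test)
    show "(\<lambda>n. 2 * (norm c)\<^sup>2 * sobolev_terms s f n + 2 * (norm d)\<^sup>2 * sobolev_terms s g n) summable_on UNIV"
      by (intro summable_on_add summable_on_cmult_right f' g')
    fix n :: int
    define x y where "x = norm (c * fourier_coeff f n)" and "y = norm (d * fourier_coeff g n)"
    have "(norm (c * fourier_coeff f n + d * fourier_coeff g n))\<^sup>2 \<le> (x + y)\<^sup>2"
      unfolding x_def y_def by (intro power_mono norm_triangle_ineq norm_ge_zero)
    also have "\<dots> \<le> 2 * x\<^sup>2 + 2 * y\<^sup>2"
      using sum_squares_bound[of x y] by (simp add: power2_sum)
    finally have "(1 + (real_of_int n)\<^sup>2) powr s * (norm (c * fourier_coeff f n + d * fourier_coeff g n))\<^sup>2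
        \<le> (1 + (real_of_int n)\<^sup>2) powr s * (2 * x\<^sup>2 + 2 * y\<^sup>2)"
      by (intro mult_left_mono) auto
    then show "sobolev_terms s (\<lambda>\<theta>. c * f \<theta> + d * g \<theta>) n \<le> 2 * (norm c)\<^sup>2 * sobolev_terms s f n + 2 * (norm d)\<^sup>2 * sobolev_terms s g n"
      by (simp add: sobolev_terms_def fc x_def y_def norm_mult power_mult_distrib algebra_simps)
  qed (simp add: sobolev_terms_def)
  then show ?thesis
    using L2_circle_lincomb[OF f'(1) g'(1)] f'(2) g'(2) by (simp add: Hs_plus_def Hs_circle_def L2_plus_def fc)
qed

definition wiener_norm :: "(real \<Rightarrow> complex) \<Rightarrow> real" where
  "wiener_norm f = (\<Sum>\<^sub>\<infinity>n. norm (fourier_coeff f (int n)))"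

lemma norm_fourier_coeff_le_wiener_norm:
  assumes "s > 1/2" "f \<in> Hs_plus s"
  shows "norm (fourier_coeff f (int n)) \<le> wiener_norm f"
  using finite_sum_le_infsum[OF Hs_plus_wiener(1)[OF assms], of "{n}"] by (simp add: wiener_norm_def)

lemma wiener_norm_nonneg: "wiener_norm f \<ge> 0"
  by (simp add: wiener_norm_def infsum_nonneg)

lemma wiener_norm_lincomb:
  assumes s: "s > 1/2" and f: "f \<in> Hs_plus s" and g: "g \<in> Hs_plus s"
  shows "wiener_norm (\<lambda>\<theta>. c * f \<theta> + d * g \<theta>) \<le> norm c * wiener_norm f + norm d * wiener_norm g"
proof -
  have i: "integrable circle f" "integrable circle g"
    using f g by (auto simp: Hs_plus_def L2_plus_integrable)
  note sf = Hs_plus_wiener(1)[OF s f] and sg = Hs_plus_wiener(1)[OF s g]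
  have "wiener_norm (\<lambda>\<theta>. c * f \<theta> + d * g \<theta>) \<le>
      (\<Sum>\<^sub>\<infinity>n. norm c * norm (fourier_coeff f (int n)) + norm d * norm (fourier_coeff g (int n)))"
    unfolding wiener_norm_def
  proof (rule infsum_mono)
    show "(\<lambda>n. norm (fourier_coeff (\<lambda>\<theta>. c * f \<theta> + d * g \<theta>) (int n))) summable_on UNIV"
      by (rule Hs_plus_wiener(1)[OF s Hs_plus_lincomb[OF f g]])
    show "norm (fourier_coeff (\<lambda>\<theta>. c * f \<theta> + d * g \<theta>) (int n)) \<le>
        norm c * norm (fourier_coeff f (int n)) + norm d * norm (fourier_coeff g (int n))" for n
      using norm_triangle_ineq[of "c * fourier_coeff f (int n)" "d * fourier_coeff g (int n)"]
      by (simp add: fourier_coeff_lincomb[OF i] norm_mult)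
  qed (intro summable_on_add summable_on_cmult_right sf sg)
  also have "\<dots> = norm c * wiener_norm f + norm d * wiener_norm g"
    unfolding wiener_norm_def
    by (subst infsum_add) (intro summable_on_cmult_right sf sg | simp add: infsum_cmult_right')+
  finally show ?thesis .
qed

text \<open>The Wiener norm is dominated by the Sobolev norm, so the error \<open>q h\<close> of the
  difference quotient tends to zero in it. Each single coefficient is then differentiable, and
  \<open>u (t + h) - u t = h (q h + v)\<close> gives continuity of the norm.\<close>

lemma time_derivative_props:
  assumes s: "s > 1/2" and u: "\<And>t. u t \<in> Hs_plus s" and d: "has_time_derivative s u v t"
  shows fourier_coeff_time_derivative:
      "((\<lambda>t. fourier_coeff (u t) (int n)) has_vector_derivative fourier_coeff v (int n)) (at t)"
    and isCont_wiener_norm: "isCont (\<lambda>t. wiener_norm (u t)) t"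
proof -
  have v: "v \<in> Hs_plus s"
    and lim: "((\<lambda>h. Hs_norm s (\<lambda>\<theta>. (u (t + h) \<theta> - u t \<theta>) / complex_of_real h - v \<theta>)) \<longlongrightarrow> 0) (at 0)"
    using d by (auto simp: has_time_derivative_def)
  define q where "q = (\<lambda>h \<theta>. (u (t + h) \<theta> - u t \<theta>) / complex_of_real h - v \<theta>)"
  define e where "e = (\<lambda>h \<theta>. 1 * u (t + h) \<theta> + (-1) * u t \<theta>)"
  have i: "integrable circle v" "integrable circle (u t)" for t
    using u v by (auto simp: Hs_plus_def L2_plus_integrable)
  have e: "e h \<in> Hs_plus s" for h
    unfolding e_def by (rule Hs_plus_lincomb[OF u u])
  then have ie: "integrable circle (e h)" for h
    by (auto simp: Hs_plus_def L2_plus_integrable)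
  have q_e: "q h = (\<lambda>\<theta>. (1 / of_real h) * e h \<theta> + (-1) * v \<theta>)" for h
    by (auto simp: q_def e_def)
  \<comment> \<open>Membership has to be checked before \<open>Hs_norm\<close> can be used, since
    that norm takes a default value on divergent families. At \<open>h = 0\<close> the quotient is
    zero by convention and \<open>q 0 = - v\<close>.\<close>
  have q: "q h \<in> Hs_plus s" for h
    unfolding q_e by (rule Hs_plus_lincomb[OF e v])
  have fe: "fourier_coeff (e h) n = fourier_coeff (u (t + h)) n - fourier_coeff (u t) n" for h n
    unfolding e_def by (subst fourier_coeff_lincomb[OF i(2) i(2)]) simp
  have fq: "fourier_coeff (q h) n = (fourier_coeff (u (t + h)) n - fourier_coeff (u t) n) / of_real h - fourier_coeff v n" for h n
    unfolding q_e by (subst fourier_coeff_lincomb[OF ie i(1)]) (simp add: fe)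
  have wq: "((\<lambda>h. wiener_norm (q h)) \<longlongrightarrow> 0) (at 0)"
  proof (rule tendsto_sandwich[where f = "\<lambda>_. 0" and h = "\<lambda>h. sobolev_constant s * Hs_norm s (q h)"])
    show "((\<lambda>h. sobolev_constant s * Hs_norm s (q h)) \<longlongrightarrow> 0) (at 0)"
      using tendsto_mult_right_zero[OF lim] by (simp add: q_def)
    show "((\<lambda>_. 0) \<longlongrightarrow> (0 :: real)) (at 0)" by simp
    show "\<forall>\<^sub>F h in at 0. 0 \<le> wiener_norm (q h)"
      by (simp add: wiener_norm_nonneg)
    show "\<forall>\<^sub>F h in at 0. wiener_norm (q h) \<le> sobolev_constant s * Hs_norm s (q h)"
      using Hs_plus_wiener(2)[OF s q] by (simp add: wiener_norm_def)
  qed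
  show "((\<lambda>t. fourier_coeff (u t) (int n)) has_vector_derivative fourier_coeff v (int n)) (at t)"
    unfolding has_vector_derivative_def has_derivative_at
  proof
    show "bounded_linear (\<lambda>h. h *\<^sub>R fourier_coeff v (int n))"
      by (rule bounded_linear_scaleR_left)
    show "(\<lambda>h. norm (fourier_coeff (u (t + h)) (int n) - fourier_coeff (u t) (int n) - h *\<^sub>R fourier_coeff v (int n)) / norm h) \<midarrow>0\<rightarrow> 0"
    proof (rule tendsto_sandwich[OF _ _ tendsto_const wq])
      have "norm (fourier_coeff (u (t + h)) (int n) - fourier_coeff (u t) (int n) - h *\<^sub>R fourier_coeff v (int n)) / norm h \<le> wiener_norm (q h)"
        if "h \<noteq> 0" for h
      proof -
        have "norm (fourier_coeff (u (t + h)) (int n) - fourier_coeff (u t) (int n) - h *\<^sub>R fourier_coeff v (int n)) / norm h = norm (fourier_coeff (q h) (int n))"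
        proof -
          have "fourier_coeff (q h) (int n) = (fourier_coeff (u (t + h)) (int n) - fourier_coeff (u t) (int n) - h *\<^sub>R fourier_coeff v (int n)) / of_real h"
            using that unfolding fq by (simp add: scaleR_conv_of_real diff_divide_distrib)
          then show ?thesis by (simp add: norm_divide)
        qed
        then show ?thesis using norm_fourier_coeff_le_wiener_norm[OF s q] by simp
      qed
      then show "\<forall>\<^sub>F h in at 0. norm (fourier_coeff (u (t + h)) (int n) - fourier_coeff (u t) (int n) - h *\<^sub>R fourier_coeff v (int n)) / norm h \<le> wiener_norm (q h)"
        by (auto simp: eventually_at_filter)
    qed auto
  qed
  have we: "wiener_norm (e h) \<le> \<bar>h\<bar> * (wiener_norm (q h) + wiener_norm v)" for h
  proof (cases "h = 0")
    case True
    then show ?thesis by (simp add: wiener_norm_def fe)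
  next
    case False
    have "e h = (\<lambda>\<theta>. of_real h * q h \<theta> + of_real h * v \<theta>)"
      using False by (auto simp: q_e algebra_simps)
    then show ?thesis
      using wiener_norm_lincomb[OF s q[of h] v, of "of_real h" "of_real h"] by (simp add: algebra_simps)
  qed
  have diff: "\<bar>wiener_norm (u (t + h)) - wiener_norm (u t)\<bar> \<le> wiener_norm (e h)" for h
  proof -
    have 1: "u (t + h) = (\<lambda>\<theta>. 1 * u t \<theta> + 1 * e h \<theta>)" and 2: "u t = (\<lambda>\<theta>. 1 * u (t + h) \<theta> + (-1) * e h \<theta>)"
      by (auto simp: e_def)
    have "wiener_norm (u (t + h)) \<le> wiener_norm (u t) + wiener_norm (e h)"
      using wiener_norm_lincomb[OF s u e, of 1 t 1 h] unfolding 1[symmetric] by simp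
    moreover have "wiener_norm (u t) \<le> wiener_norm (u (t + h)) + wiener_norm (e h)"
      using wiener_norm_lincomb[OF s u e, of 1 "t + h" "-1" h] unfolding 2[symmetric] by simp
    ultimately show ?thesis by linarith
  qed
  have "((\<lambda>h. \<bar>h\<bar> * (wiener_norm (q h) + wiener_norm v)) \<longlongrightarrow> \<bar>0\<bar> * (0 + wiener_norm v)) (at 0)"
    by (intro tendsto_intros wq)
  then have "((\<lambda>h. \<bar>h\<bar> * (wiener_norm (q h) + wiener_norm v)) \<longlongrightarrow> 0) (at 0)" by simp
  then have "((\<lambda>h. wiener_norm (u (t + h)) - wiener_norm (u t)) \<longlongrightarrow> 0) (at 0)"
    by (rule Lim_null_comparison[rotated]) (use order_trans[OF diff we] in simp)
  then have "((\<lambda>h. wiener_norm (u (t + h))) \<longlongrightarrow> wiener_norm (u t)) (at 0)"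
    by (simp add: LIM_zero_iff)
  then show "isCont (\<lambda>t. wiener_norm (u t)) t"
    by (simp add: isCont_iff)
qed

section \<open>Fourier coefficients of the right-hand side\<close>

lemma szego_proj_cubic_props:
  assumes f: "f \<in> L2_plus" and a: "(\<lambda>n. norm (fourier_coeff f (int n))) summable_on UNIV"
  shows szego_proj_cubic_L2_plus: "szego_proj (cubic f) \<in> L2_plus"
    and fourier_coeff_szego_proj_cubic:
      "fourier_coeff (szego_proj (cubic f)) (int n) = cubic_coeff (\<lambda>n. fourier_coeff f (int n)) n"
  unfolding szego_proj_def fourier_coeff_cubic[OF f a]
  by (rule hardy_synth_L2_plus fourier_coeff_hardy_synth; rule cubic_coeff_abs_summable[OF a])+

text \<open>Only the modes \<open>Suc n\<close> enter the Hankel matrix. The outer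
  \<open>shift\<close> lowers the index to \<open>n\<close> in the second term, and
  \<open>shift_adj\<close> replaces the coefficients by the shifted sequence.\<close>

lemma fourier_coeff_beta_szego_rhs:
  assumes f: "f \<in> L2_plus" and a: "(\<lambda>n. norm (fourier_coeff f (int n))) summable_on UNIV"
  shows "beta_szego_rhs \<beta> f \<in> borel_measurable circle"
    and "fourier_coeff (beta_szego_rhs \<beta> f) (int (Suc n)) =
      cubic_coeff (\<lambda>n. fourier_coeff f (int n)) (Suc n) - of_real \<beta> * cubic_coeff (\<lambda>n. fourier_coeff f (int (Suc n))) n"
proof -
  have a': "(\<lambda>n. norm (fourier_coeff f (int (n + 1)))) summable_on UNIV"
    using abs_summable_Suc(1)[OF a] by simp
  have g: "shift_adj f \<in> L2_plus" "\<And>n. fourier_coeff (shift_adj f) (int n) = fourier_coeff f (int (n + 1))"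
    unfolding shift_adj_def using hardy_synth_props[OF a'] by auto
  have ga: "(\<lambda>n. norm (fourier_coeff (shift_adj f) (int n))) summable_on UNIV"
    unfolding g(2) by (rule a')
  define p where "p = szego_proj (cubic f)"
  define r where "r = szego_proj (cubic (shift_adj f))"
  have p: "p \<in> L2_plus" "\<And>n. fourier_coeff p (int n) = cubic_coeff (\<lambda>n. fourier_coeff f (int n)) n"
    unfolding p_def by (fact szego_proj_cubic_props[OF f a])+
  have r: "r \<in> L2_plus" "\<And>n. fourier_coeff r (int n) = cubic_coeff (\<lambda>n. fourier_coeff f (int (Suc n))) n"
    unfolding r_def using szego_proj_cubic_props[OF g(1) ga] by (simp_all add: g(2))
  have ip: "integrable circle p" and ir: "integrable circle r"
    using p r by (simp_all add: L2_plus_integrable)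
  have sh: "shift r = (\<lambda>\<theta>. r \<theta> * cis (real_of_int 1 * \<theta>))"
    by (auto simp: shift_def)
  have ish: "integrable circle (shift r)"
    unfolding sh by (rule integrable_circle_mult_cis[OF ir])
  have fs: "fourier_coeff (shift r) n = fourier_coeff r (n - 1)" for n
    unfolding sh by (rule fourier_coeff_mult_cis)
  have rhs: "beta_szego_rhs \<beta> f = (\<lambda>\<theta>. 1 * p \<theta> + (- of_real \<beta>) * shift r \<theta>)"
    by (simp add: beta_szego_rhs_def p_def r_def)
  have "integrable circle (\<lambda>\<theta>. 1 * p \<theta> + (- of_real \<beta>) * shift r \<theta>)"
    using ip ish by (intro Bochner_Integration.integrable_add integrable_mult_right)
  then show "beta_szego_rhs \<beta> f \<in> borel_measurable circle"
    unfolding rhs by (rule borel_measurable_integrable)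
  have "fourier_coeff (beta_szego_rhs \<beta> f) (int (Suc n)) = fourier_coeff p (int (Suc n)) - of_real \<beta> * fourier_coeff r (int n)"
    unfolding rhs by (subst fourier_coeff_lincomb[OF ip ish]) (simp add: fs)
  then show "fourier_coeff (beta_szego_rhs \<beta> f) (int (Suc n)) =
      cubic_coeff (\<lambda>n. fourier_coeff f (int n)) (Suc n) - of_real \<beta> * cubic_coeff (\<lambda>n. fourier_coeff f (int (Suc n))) n"
    by (simp only: p(2) r(2))
qed

section \<open>Evolution of the Hankel matrix\<close>

text \<open>The matrix of -i times the Toeplitz operator with symbol |u|^2 - \<beta> |w|^2, where w
  is \<open>shift_adj u\<close>.\<close>

definition left_generator :: "real \<Rightarrow> (nat \<Rightarrow> complex) \<Rightarrow> nat \<Rightarrow> nat \<Rightarrow> complex" where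
  "left_generator \<beta> a j l = - \<i> * (toeplitz_entry a j l - of_real \<beta> * toeplitz_entry (\<lambda>n. a (Suc n)) j l)"

text \<open>The column index \<open>k\<close> comes first: this matrix acts from the right through
  its transpose, so its row sums are the quantities to bound. The offset is 1 for \<open>a\<close>
  but 0 for the shifted sequence, which already contains the shift.\<close>

definition right_generator :: "real \<Rightarrow> (nat \<Rightarrow> complex) \<Rightarrow> nat \<Rightarrow> nat \<Rightarrow> complex" where
  "right_generator \<beta> a k q = - \<i> * (truncated_entry 1 a k q - of_real \<beta> * truncated_entry 0 (\<lambda>n. a (Suc n)) k q)"

lemma lincomb_abs_summable:
  fixes x y :: "'a \<Rightarrow> complex"
  assumes x: "(\<lambda>l. norm (x l)) summable_on UNIV" "(\<Sum>\<^sub>\<infinity>l. norm (x l)) \<le> K"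
    and y: "(\<lambda>l. norm (y l)) summable_on UNIV" "(\<Sum>\<^sub>\<infinity>l. norm (y l)) \<le> K"
  shows "(\<lambda>l. norm (- \<i> * (x l - of_real \<beta> * y l))) summable_on UNIV"
    and "(\<Sum>\<^sub>\<infinity>l. norm (- \<i> * (x l - of_real \<beta> * y l))) \<le> (1 + \<bar>\<beta>\<bar>) * K"
proof -
  have le: "norm (- \<i> * (x l - of_real \<beta> * y l)) \<le> norm (x l) + \<bar>\<beta>\<bar> * norm (y l)" for l
    using norm_triangle_ineq4[of "x l" "of_real \<beta> * y l"] by (simp add: norm_mult)
  have s: "(\<lambda>l. norm (x l) + \<bar>\<beta>\<bar> * norm (y l)) summable_on UNIV"
    by (intro summable_on_add summable_on_cmult_right x y)
  show s': "(\<lambda>l. norm (- \<i> * (x l - of_real \<beta> * y l))) summable_on UNIV"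
    by (rule summable_on_comparison_test[OF s le]) simp
  have "(\<Sum>\<^sub>\<infinity>l. norm (- \<i> * (x l - of_real \<beta> * y l))) \<le> (\<Sum>\<^sub>\<infinity>l. norm (x l) + \<bar>\<beta>\<bar> * norm (y l))"
    by (rule infsum_mono[OF s' s le])
  also have "\<dots> = (\<Sum>\<^sub>\<infinity>l. norm (x l)) + \<bar>\<beta>\<bar> * (\<Sum>\<^sub>\<infinity>l. norm (y l))"
    by (subst infsum_add) (intro summable_on_cmult_right x y | simp add: infsum_cmult_right')+
  also have "\<dots> \<le> K + \<bar>\<beta>\<bar> * K"
    by (intro add_mono mult_left_mono x y) simp
  finally show "(\<Sum>\<^sub>\<infinity>l. norm (- \<i> * (x l - of_real \<beta> * y l))) \<le> (1 + \<bar>\<beta>\<bar>) * K"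
    by (simp add: distrib_right)
qed

lemma generator_bounds:
  assumes a: "(\<lambda>n. norm (a n)) summable_on UNIV"
  shows "(\<lambda>l. norm (left_generator \<beta> a j l)) summable_on UNIV"
    and "(\<Sum>\<^sub>\<infinity>l. norm (left_generator \<beta> a j l)) \<le> (1 + \<bar>\<beta>\<bar>) * (\<Sum>\<^sub>\<infinity>n. norm (a n))\<^sup>2"
    and "(\<lambda>l. norm (right_generator \<beta> a j l)) summable_on UNIV"
    and "(\<Sum>\<^sub>\<infinity>l. norm (right_generator \<beta> a j l)) \<le> (1 + \<bar>\<beta>\<bar>) * (\<Sum>\<^sub>\<infinity>n. norm (a n))\<^sup>2"
proof -
  note a' = abs_summable_Suc[OF a]
  have sq: "(\<Sum>\<^sub>\<infinity>n. norm (a (Suc n)))\<^sup>2 \<le> (\<Sum>\<^sub>\<infinity>n. norm (a n))\<^sup>2"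
    by (intro power_mono a' infsum_nonneg) simp
  note L = toeplitz_entry_bound[OF a] toeplitz_entry_bound(1)[OF a'(1)]
    order_trans[OF toeplitz_entry_bound(2)[OF a'(1)] sq]
  note R = truncated_entry_bound[OF a] truncated_entry_bound(1)[OF a'(1)]
    order_trans[OF truncated_entry_bound(2)[OF a'(1)] sq]
  show "(\<lambda>l. norm (left_generator \<beta> a j l)) summable_on UNIV"
    "(\<Sum>\<^sub>\<infinity>l. norm (left_generator \<beta> a j l)) \<le> (1 + \<bar>\<beta>\<bar>) * (\<Sum>\<^sub>\<infinity>n. norm (a n))\<^sup>2"
    unfolding left_generator_def by (rule lincomb_abs_summable[OF L])+
  show "(\<lambda>l. norm (right_generator \<beta> a j l)) summable_on UNIV"
    "(\<Sum>\<^sub>\<infinity>l. norm (right_generator \<beta> a j l)) \<le> (1 + \<bar>\<beta>\<bar>) * (\<Sum>\<^sub>\<infinity>n. norm (a n))\<^sup>2"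
    unfolding right_generator_def by (rule lincomb_abs_summable[OF R])+
qed

lemma abs_summable_mult_bounded:
  fixes x y :: "'a \<Rightarrow> complex"
  assumes x: "(\<lambda>l. norm (x l)) summable_on UNIV" and y: "\<And>l. norm (y l) \<le> R"
  shows "(\<lambda>l. x l * y l) summable_on UNIV"
proof (rule abs_summable_summable, rule summable_on_comparison_test)
  show "(\<lambda>l. norm (x l) * R) summable_on UNIV" by (intro summable_on_cmult_left x)
  show "norm (x l * y l) \<le> norm (x l) * R" for l
    using y by (simp add: norm_mult mult_left_mono)
qed simp

text \<open>Splitting \<open>a\<close> at \<open>j + k + 1\<close> with offset 1 and the shifted
  sequence at \<open>j + k\<close> with offset 0 produces entries of the same matrix
  \<open>hankel a\<close>, so the two cubic terms combine linearly.\<close>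

lemma cubic_coeff_generator_form:
  assumes a: "(\<lambda>n. norm (a n)) summable_on UNIV"
  shows "- \<i> * (cubic_coeff a (Suc (j + k)) - of_real \<beta> * cubic_coeff (\<lambda>n. a (Suc n)) (j + k)) =
    (\<Sum>\<^sub>\<infinity>l. left_generator \<beta> a j l * hankel a l k) + (\<Sum>\<^sub>\<infinity>q. right_generator \<beta> a k q * hankel a j q)"
proof -
  define b where "b = (\<lambda>n. a (Suc n))"
  have b: "(\<lambda>n. norm (b n)) summable_on UNIV" unfolding b_def by (rule abs_summable_Suc[OF a])
  have hb: "norm (hankel a i l) \<le> (\<Sum>\<^sub>\<infinity>n. norm (a n))" for i l
    unfolding hankel_def by (rule norm_le_infsum_norm[OF a])
  have lin: "(\<Sum>\<^sub>\<infinity>l. - \<i> * (x l - of_real \<beta> * y l) * h l) = - \<i> * ((\<Sum>\<^sub>\<infinity>l. x l * h l) - of_real \<beta> * (\<Sum>\<^sub>\<infinity>l. y l * h l))"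
    if x: "(\<lambda>l. norm (x l)) summable_on UNIV" and y: "(\<lambda>l. norm (y l)) summable_on UNIV"
      and h: "\<And>l. norm (h l) \<le> (\<Sum>\<^sub>\<infinity>n. norm (a n))" for x y h :: "nat \<Rightarrow> complex"
  proof (rule infsumI)
    have "((\<lambda>l. - \<i> * (x l * h l + (- of_real \<beta>) * (y l * h l))) has_sum
        - \<i> * ((\<Sum>\<^sub>\<infinity>l. x l * h l) + (- of_real \<beta>) * (\<Sum>\<^sub>\<infinity>l. y l * h l))) UNIV"
      by (intro has_sum_cmult_right has_sum_add has_sum_infsum abs_summable_mult_bounded[OF x h] abs_summable_mult_bounded[OF y h])
    then show "((\<lambda>l. - \<i> * (x l - of_real \<beta> * y l) * h l) has_sum - \<i> * ((\<Sum>\<^sub>\<infinity>l. x l * h l) - of_real \<beta> * (\<Sum>\<^sub>\<infinity>l. y l * h l))) UNIV"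
      by (simp add: algebra_simps)
  qed
  have 1: "cubic_coeff a (Suc (j + k)) = (\<Sum>\<^sub>\<infinity>l. toeplitz_entry a j l * hankel a l k) + (\<Sum>\<^sub>\<infinity>q. truncated_entry 1 a k q * hankel a j q)"
    using cubic_coeff_split[OF a, of 1 j k] by (simp add: hankel_def)
  have 2: "cubic_coeff b (j + k) = (\<Sum>\<^sub>\<infinity>l. toeplitz_entry b j l * hankel a l k) + (\<Sum>\<^sub>\<infinity>q. truncated_entry 0 b k q * hankel a j q)"
    using cubic_coeff_split[OF b, of 0 j k] by (simp add: hankel_def b_def)
  show ?thesis
    unfolding left_generator_def right_generator_def b_def[symmetric]
      lin[OF toeplitz_entry_bound(1)[OF a] toeplitz_entry_bound(1)[OF b] hb]
      lin[OF truncated_entry_bound(1)[OF a] truncated_entry_bound(1)[OF b] hb] 1 2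
    by (simp add: algebra_simps)
qed

lemma beta_szego_hankel_minors_zero:
  assumes s: "s > 1/2" and sol: "beta_szego_solution \<beta> s u"
    and zero: "\<And>I J. minor n (hankel (\<lambda>n. fourier_coeff (u t0) (int n))) I J = 0"
  shows "minor n (hankel (\<lambda>n. fourier_coeff (u t1) (int n))) I J = 0"
proof -
  have u: "u t \<in> Hs_plus s" for t using sol by (simp add: beta_szego_solution_def)
  obtain v where v: "\<And>t. has_time_derivative s u (v t) t"
    and eqn: "\<And>t. AE \<theta> in circle. \<i> * v t \<theta> = beta_szego_rhs \<beta> (u t) \<theta>"
    using sol unfolding beta_szego_solution_def by metis
  define c where "c = (\<lambda>t n. fourier_coeff (u t) (int n))"
  have c: "(\<lambda>n. norm (c t n)) summable_on UNIV" for t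
    unfolding c_def by (rule Hs_plus_wiener(1)[OF s u])
  have uL: "u t \<in> L2_plus" for t using u[of t] by (simp add: Hs_plus_def)
  have vL: "v t \<in> L2_plus" for t using v[of t] by (simp add: has_time_derivative_def Hs_plus_def)
  have vc: "fourier_coeff (v t) (int (Suc n)) = - \<i> * (cubic_coeff (c t) (Suc n) - of_real \<beta> * cubic_coeff (\<lambda>n. c t (Suc n)) n)" for t n
  proof -
    note cs = c[of t, unfolded c_def]
    have [measurable]: "v t \<in> borel_measurable circle"
      using vL[of t] by (simp add: L2_plus_def L2_circle_def)
    have "\<i> * fourier_coeff (v t) (int (Suc n)) = fourier_coeff (\<lambda>\<theta>. \<i> * v t \<theta>) (int (Suc n))"
      by (rule fourier_coeff_cmult[symmetric])
    also have "\<dots> = fourier_coeff (beta_szego_rhs \<beta> (u t)) (int (Suc n))"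
      by (rule fourier_coeff_cong_AE[OF eqn _ fourier_coeff_beta_szego_rhs(1)[OF uL cs]]) measurable
    also have "\<dots> = cubic_coeff (c t) (Suc n) - of_real \<beta> * cubic_coeff (\<lambda>n. c t (Suc n)) n"
      unfolding c_def by (rule fourier_coeff_beta_szego_rhs(2)[OF uL cs])
    finally have "- \<i> * (\<i> * fourier_coeff (v t) (int (Suc n))) = - \<i> * (cubic_coeff (c t) (Suc n) - of_real \<beta> * cubic_coeff (\<lambda>n. c t (Suc n)) n)"
      by simp
    then show ?thesis by (simp flip: mult.assoc)
  qed
  \<comment> \<open>Compactness of the time segment turns the row bounds at each time into a single
    constant.\<close>
  have "continuous_on (closed_segment t0 t1) (\<lambda>t. wiener_norm (u t))"
    using isCont_wiener_norm[OF s u v] by (intro continuous_at_imp_continuous_on) blast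
  then have "compact ((\<lambda>t. wiener_norm (u t)) ` closed_segment t0 t1)"
    by (intro compact_continuous_image compact_segment)
  then have "bdd_above ((\<lambda>t. wiener_norm (u t)) ` closed_segment t0 t1)"
    by (intro bounded_imp_bdd_above compact_imp_bounded)
  then obtain R where R: "\<And>t. t \<in> closed_segment t0 t1 \<Longrightarrow> wiener_norm (u t) \<le> R"
    by (auto simp: bdd_above_def)
  have K: "(\<Sum>\<^sub>\<infinity>n. norm (c t n))\<^sup>2 \<le> R\<^sup>2" if "t \<in> closed_segment t0 t1" for t
    using R[OF that] wiener_norm_nonneg[of "u t"] by (auto simp: wiener_norm_def c_def intro: power_mono)
  have bound: "x \<le> (1 + \<bar>\<beta>\<bar>) * R\<^sup>2" if "x \<le> (1 + \<bar>\<beta>\<bar>) * (\<Sum>\<^sub>\<infinity>n. norm (c t n))\<^sup>2" "t \<in> closed_segment t0 t1" for x t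
    using that(1) by (rule order_trans) (intro mult_left_mono K that(2), simp)
  have hb: "norm (hankel (c t) i l) \<le> (\<Sum>\<^sub>\<infinity>n. norm (c t n))" for t i l
    unfolding hankel_def by (rule norm_le_infsum_norm[OF c])
  have "minor n (hankel (c t1)) I J = 0"
  proof (rule minors_zero_propagate[where G = "\<lambda>t. hankel (c t)" and ?t0.0 = t0 and R = R and K = "(1 + \<bar>\<beta>\<bar>) * R\<^sup>2"
        and A = "\<lambda>t. left_generator \<beta> (c t)" and B = "\<lambda>t. right_generator \<beta> (c t)"
        and X = "\<lambda>t j k. \<Sum>\<^sub>\<infinity>l. left_generator \<beta> (c t) j l * hankel (c t) l k"
        and Y = "\<lambda>t j k. \<Sum>\<^sub>\<infinity>l. right_generator \<beta> (c t) k l * hankel (c t) j l"])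
    fix t i j
    show "((\<lambda>t. hankel (c t) i j) has_vector_derivative
        (\<Sum>\<^sub>\<infinity>l. left_generator \<beta> (c t) i l * hankel (c t) l j) + (\<Sum>\<^sub>\<infinity>l. right_generator \<beta> (c t) j l * hankel (c t) i l)) (at t)"
      using fourier_coeff_time_derivative[OF s u v, of "Suc (i + j)" t]
      unfolding vc cubic_coeff_generator_form[OF c] by (simp add: hankel_def c_def)
    show "((\<lambda>l. left_generator \<beta> (c t) i l * hankel (c t) l j) has_sum (\<Sum>\<^sub>\<infinity>l. left_generator \<beta> (c t) i l * hankel (c t) l j)) UNIV"
      by (rule has_sum_infsum[OF abs_summable_mult_bounded[OF generator_bounds(1)[OF c] hb]])
    show "((\<lambda>l. right_generator \<beta> (c t) j l * hankel (c t) i l) has_sum (\<Sum>\<^sub>\<infinity>l. right_generator \<beta> (c t) j l * hankel (c t) i l)) UNIV"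
      by (rule has_sum_infsum[OF abs_summable_mult_bounded[OF generator_bounds(3)[OF c] hb]])
  next
    fix t i j assume t: "t \<in> closed_segment t0 t1"
    show "(\<Sum>\<^sub>\<infinity>l. norm (left_generator \<beta> (c t) i l)) \<le> (1 + \<bar>\<beta>\<bar>) * R\<^sup>2"
      by (rule bound[OF generator_bounds(2)[OF c] t])
    show "(\<Sum>\<^sub>\<infinity>l. norm (right_generator \<beta> (c t) i l)) \<le> (1 + \<bar>\<beta>\<bar>) * R\<^sup>2"
      by (rule bound[OF generator_bounds(4)[OF c] t])
    show "norm (hankel (c t) i j) \<le> R"
      using hb[of t i j] R[OF t] by (simp add: wiener_norm_def c_def)
  next
    show "minor n (hankel (c t0)) I J = 0" for I J
      using zero by (simp add: c_def)
  qed (rule generator_bounds(1)[OF c] generator_bounds(3)[OF c])+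
  then show ?thesis by (simp add: c_def)
qed

theorem mainTheorem8:
  fixes \<beta> s :: real and D :: nat and u :: "real \<Rightarrow> real \<Rightarrow> complex"
  assumes "D \<ge> 1"
    and "s > 1/2"
    and "beta_szego_solution \<beta> s u"
    and "u 0 \<in> rational_manifold D"
  shows "\<forall>t. u t \<in> rational_manifold D"
proof
  fix t
  obtain r where D: "D = Suc r" using assms(1) by (cases D) auto
  have u: "u t \<in> Hs_plus s" for t using assms(3) by (simp add: beta_szego_solution_def)
  then have uL: "u t \<in> L2_plus" for t by (simp add: Hs_plus_def)
  note iff = rational_manifold_iff_hankel_minors[OF uL Hs_plus_wiener(1)[OF assms(2) u]]
  \<comment> \<open>Vanishing in size \<open>Suc r + 1\<close> is carried from time 0 to
    \<open>t\<close>. Nonvanishing in size \<open>Suc r\<close> is the contrapositive of propagation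
    from \<open>t\<close> back to 0.\<close>
  show "u t \<in> rational_manifold D"
    using assms(4) beta_szego_hankel_minors_zero[OF assms(2,3)] unfolding D iff by blast
qed

end
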